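(* Let $N,N'$ be integers with $2\le N'\le N-2$. Among lower triangular $H\in\mathbb{R}^{(N-1)\times(N-1)}$ with nonzero diagonal entries, the unique set of values of the Q-functions $Q(N-1,k,j)$ ($j=1,\dots,N-1$, $k=1,\dots,N-j$) satisfying - $\lambda^\star_{j+2,j}=\lambda^\star_{j+3,j}=\cdots=\lambda^\star_{N,j}=0$ for $j=1,\dots,N'-1$, - $\lambda^\star_{j+1,j}=\lambda^\star_{j+2,j}=\cdots=\lambda^\star_{N-1,j}=0$ for $j=N',\dots,N-1$ (vacuous for $j=N-1$), and - the H-invariance condition $\sum_{j=1}^{N-m}Q(N-1,m,j)=\frac1N\binom{N}{m+1}$ for $m=1,\dots,N-1$, is given by $$Q(N-1,k,j)=\begin{cases}\frac jN\binom{N-j-1}{k-1} & \text{for } j=1,\dots,N'-1,\\[1mm] \frac{N'(N-N'+1)}{N(k+1)}\binom{N-N'-1}{k-1} & \text{for } j=N',\\[1mm] \frac1{k+1}\binom{N-j-1}{k-1} & \text{for } j=N'+1,\dots,N-1,\end{cases}\qquad k=1,\dots,N-j.$$ With these Q-functions, $\lambda^\star_{j+1,j}>0$ for $j=1,\dots,N'-1$ and $\lambda^\star_{N,j}>0$ for $j=N',\dots,N-1$, so the corresponding $H$ represents a minimax optimal algorithm.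
   Context: For a lower triangular $H=(h_{i,j})\in\mathbb{R}^{(N-1)\times(N-1)}$ (dependence on $H$ suppressed), define for $m,j\in\{1,\dots,N-1\}$ $$Q(N-1,m,j)=\sum_{j=j(1)\le i(1)<j(2)\le i(2)<\cdots<j(m)\le i(m)\le N-1}\ \prod_{r=1}^m h_{i(r),j(r)}$$ (empty sums are $0$). The H-certificates $\lambda^\star_{k,j}$, $1\le j<k\le N$, are $$\lambda^\star_{N,j}=N\sum_{m=1}^{N-j}(-1)^{m-1}Q(N-1,m,j),\qquad j=1,\dots,N-1,$$ $$\lambda^\star_{k,j}=N\sum_{\ell=1}^{N-j}\sum_{m=1}^{N-k}(-1)^{\ell+m-1}\binom{\ell+m}{m}Q(N-1,\ell,j)\,Q(N-1,m,k),\qquad 1\le j<k\le N-1.$$ The map sending a lower triangular $H$ with nonzero diagonal entries to the family $(Q(N-1,k,j))_{1\le j\le N-1,\,1\le k\le N-j}$ is a one-to-one correspondence onto the families with $Q(N-1,N-j,j)\ne0$ for all $j$; "the corresponding $H$" refers to this correspondence. $H$ represents a minimax optimal algorithm if, for every $d\ge1$, every nonexpansive (1-Lipschitz) $T:\mathbb{R}^d\to\mathbb{R}^d$ with a fixed point $y_\star$ and every $y_0\in\mathbb{R}^d$, the iterates $y_{k+1}=y_k-\sum_{j=0}^kh_{k+1,j+1}(y_j-Ty_j)$, $k=0,\dots,N-2$, satisfy $\|y_{N-1}-Ty_{N-1}\|^2\le\frac{4\|y_0-y_\star\|^2}{N^2}$. *)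

theory Defs
  imports Complex_Main "HOL-Library.FuncSet" "Jordan_Normal_Form.Matrix"
begin

text \<open>Entries are numbered from 1, whereas the library numbers rows and columns from 0.\<close>

definition entry :: "real mat \<Rightarrow> nat \<Rightarrow> nat \<Rightarrow> real" where
  "entry H i j = H $$ (i - 1, j - 1)"

definition lower_triangular_nz :: "nat \<Rightarrow> real mat set" where
  "lower_triangular_nz n = {H \<in> carrier_mat n n.
     (\<forall>i\<in>{1..n}. \<forall>j\<in>{1..n}. i < j \<longrightarrow> entry H i j = 0) \<and>
     (\<forall>i\<in>{1..n}. entry H i i \<noteq> 0)}"

text \<open>The index sequences \<open>a = J 1 \<le> I 1 < J 2 \<le> I 2 < \<dots> < J m \<le> I m \<le> n\<close>, for \<open>m \<ge> 1\<close>.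
  Extensionality outside \<open>{1..m}\<close> makes each pair of sequences occur exactly once.\<close>

definition index_chains :: "nat \<Rightarrow> nat \<Rightarrow> nat \<Rightarrow> ((nat \<Rightarrow> nat) \<times> (nat \<Rightarrow> nat)) set" where
  "index_chains n m a = {(J, I).
     J \<in> {1..m} \<rightarrow>\<^sub>E {1..n} \<and> I \<in> {1..m} \<rightarrow>\<^sub>E {1..n} \<and> J 1 = a \<and>
     (\<forall>r\<in>{1..m}. J r \<le> I r) \<and> (\<forall>r\<in>{1..<m}. I r < J (r + 1))}"

definition Q :: "real mat \<Rightarrow> nat \<Rightarrow> nat \<Rightarrow> nat \<Rightarrow> real" where
  "Q H n m j = (\<Sum>(J, I)\<in>index_chains n m j. \<Prod>r=1..m. entry H (I r) (J r))"

text \<open>The H-certificate \<open>\<lambda>\<^sup>\<star>\<^bsub>k,j\<^esub>\<close>, meaningful for \<open>1 \<le> j < k \<le> N\<close>. The exponent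
  \<open>\<ell> + m - 1\<close> does not truncate, since \<open>\<ell>\<close> and \<open>m\<close> are positive.\<close>

definition H_cert :: "nat \<Rightarrow> real mat \<Rightarrow> nat \<Rightarrow> nat \<Rightarrow> real" where
  "H_cert N H k j =
     (if k = N
      then real N * (\<Sum>m=1..N-j. (-1) ^ (m - 1) * Q H (N - 1) m j)
      else real N * (\<Sum>l=1..N-j. \<Sum>m=1..N-k.
             (-1) ^ (l + m - 1) * real ((l + m) choose m) * Q H (N - 1) l j * Q H (N - 1) m k))"

definition vnorm :: "real vec \<Rightarrow> real" where
  "vnorm x = sqrt (x \<bullet> x)"

definition nonexpansive :: "nat \<Rightarrow> (real vec \<Rightarrow> real vec) \<Rightarrow> bool" where
  "nonexpansive d T \<longleftrightarrow> T \<in> carrier_vec d \<rightarrow> carrier_vec d \<and>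
     (\<forall>x\<in>carrier_vec d. \<forall>z\<in>carrier_vec d. vnorm (T x - T z) \<le> vnorm (x - z))"

text \<open>The space \<open>\<real>\<^sup>d\<close> is \<open>carrier_vec d\<close>, so that the dimension can be quantified inside the
  definition. The recurrence determines \<open>y 1, \<dots>, y (N - 1)\<close> from \<open>y 0\<close>.\<close>

definition minimax_optimal :: "nat \<Rightarrow> real mat \<Rightarrow> bool" where
  "minimax_optimal N H \<longleftrightarrow>
     (\<forall>d\<ge>1. \<forall>T y ystar.
        nonexpansive d T \<longrightarrow>
        ystar \<in> carrier_vec d \<longrightarrow> T ystar = ystar \<longrightarrow>
        y 0 \<in> carrier_vec d \<longrightarrow>
        (\<forall>k<N - 1. y (k + 1) =
           y k - finsum_vec TYPE(real) d
                   (\<lambda>j. entry H (k + 1) (j + 1) \<cdot>\<^sub>v (y j - T (y j))) {0..k}) \<longrightarrow>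
        (vnorm (y (N - 1) - T (y (N - 1))))\<^sup>2 \<le> 4 * (vnorm (y 0 - ystar))\<^sup>2 / (real N)\<^sup>2)"

definition Q_value :: "nat \<Rightarrow> nat \<Rightarrow> nat \<Rightarrow> nat \<Rightarrow> real" where
  "Q_value N N' k j =
     (if j < N' then real j / real N * real ((N - j - 1) choose (k - 1))
      else if j = N' then
        real (N' * (N - N' + 1)) / real (N * (k + 1)) * real ((N - N' - 1) choose (k - 1))
      else 1 / real (k + 1) * real ((N - j - 1) choose (k - 1)))"

definition has_Q_values :: "nat \<Rightarrow> nat \<Rightarrow> real mat \<Rightarrow> bool" where
  "has_Q_values N N' H \<longleftrightarrow>
     (\<forall>j\<in>{1..N-1}. \<forall>k\<in>{1..N-j}. Q H (N - 1) k j = Q_value N N' k j)"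

end

theory Submission
  imports Defs "HOL-Computational_Algebra.Polynomial"
begin

text \<open>Let \<open>q\<^sub>j(x)\<close> be the generating polynomial of \<open>k \<mapsto> Q(N-1,k,j)\<close>, put \<open>q\<^sub>N = 1\<close>, and let
  \<open>u\<^sub>j(z) = -q\<^sub>j(z-1)\<close>. Then \<open>\<lambda>\<^sup>\<star>\<^bsub>k,j\<^esub> = -N \<langle>u\<^sub>j, u\<^sub>k\<rangle>\<close> for the inner product of coefficient vectors, and
  H-invariance says that \<open>u\<^sub>1 + \<dots> + u\<^sub>N\<close> has all its \<open>N\<close> coefficients equal to \<open>-1/N\<close>. The vanishing
  certificates are orthogonality relations which fix every \<open>u\<^sub>j\<close> up to a scalar; as the degrees
  \<open>N-j\<close> are distinct, H-invariance fixes the scalars.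

  Splitting off the first factor in \<open>Q\<close> gives
  \<open>u\<^sub>a = (z-1) \<Sum>\<^sub>k h\<^bsub>k,a\<^esub> \<Sum>\<^bsub>j>k\<^esub> u\<^sub>j\<close>. This is triangular in the column \<open>a\<close> of \<open>H\<close>, hence the
  correspondence between \<open>H\<close> and its Q-functions. It also evaluates the quadratic form in the residuals
  \<open>g\<^sub>j\<close> obtained by weighting the nonexpansiveness inequalities with \<open>\<lambda>\<^sup>\<star>\<close>: under H-invariance it equals
  \<open>\<langle>x\<^sub>1 - x\<^sub>N, g\<^sub>N\<rangle> - (N-1)/2 |g\<^sub>N|\<^sup>2\<close>. If all certificates are nonnegative, adding the inequality
  between \<open>x\<^sub>N\<close> and the fixed point gives the minimax rate.\<close>

section \<open>Generating polynomials of the Q-functions\<close>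

lemma finite_index_chains: "finite (index_chains n m a)"
  by (rule finite_subset[of _ "({1..m} \<rightarrow>\<^sub>E {1..n}) \<times> ({1..m} \<rightarrow>\<^sub>E {1..n})"])
    (auto simp: index_chains_def intro!: finite_PiE)

lemma Q_one:
  assumes "1 \<le> a" "a \<le> n"
  shows "Q H n 1 a = (\<Sum>i=a..n. entry H i a)"
  unfolding Q_def
  by (rule sum.reindex_bij_witness[where
        j = "\<lambda>(J, I). I 1" and i = "\<lambda>i. (\<lambda>r\<in>{1..1}. a, \<lambda>r\<in>{1..1}. i)"])
    (use assms in \<open>auto simp: index_chains_def PiE_iff extensional_def restrict_def fun_eq_iff\<close>)

text \<open>The first pair of a chain is \<open>(a, i)\<close>; the remaining pairs, renumbered down
  by one, form an arbitrary chain of length \<open>m\<close> whose start \<open>j\<close> exceeds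
  \<open>i\<close>. The sum is reindexed along this bijection.\<close>

lemma Q_Suc:
  assumes "1 \<le> a" "1 \<le> m"
  shows "Q H n (Suc m) a = (\<Sum>i=a..n. entry H i a * (\<Sum>j=i+1..n. Q H n m j))"
proof -
  define S where "S = Sigma {a..n} (\<lambda>i. Sigma {i+1..n} (index_chains n m))"
  define join :: "nat \<times> nat \<times> (nat \<Rightarrow> nat) \<times> (nat \<Rightarrow> nat) \<Rightarrow> (nat \<Rightarrow> nat) \<times> (nat \<Rightarrow> nat)"
    where "join = (\<lambda>(i, j, J, I). (\<lambda>r\<in>{1..Suc m}. if r = 1 then a else J (r - 1),
                                   \<lambda>r\<in>{1..Suc m}. if r = 1 then i else I (r - 1)))"
  define split :: "(nat \<Rightarrow> nat) \<times> (nat \<Rightarrow> nat) \<Rightarrow> nat \<times> nat \<times> (nat \<Rightarrow> nat) \<times> (nat \<Rightarrow> nat)"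
    where "split = (\<lambda>(J, I). (I 1, J 2, \<lambda>r\<in>{1..m}. J (r + 1), \<lambda>r\<in>{1..m}. I (r + 1)))"
  have join_chain: "join s \<in> index_chains n (Suc m) a" if "s \<in> S" for s
  proof -
    obtain i j J I where s: "s = (i, j, J, I)" by (cases s)
    have i: "a \<le> i" "i \<le> n" and j: "i < j" "j \<le> n"
      and JI: "J \<in> {1..m} \<rightarrow>\<^sub>E {1..n}" "I \<in> {1..m} \<rightarrow>\<^sub>E {1..n}" "J 1 = j"
        "\<And>r. r \<in> {1..m} \<Longrightarrow> J r \<le> I r" "\<And>r. r \<in> {1..<m} \<Longrightarrow> I r < J (r + 1)"
      using that by (auto simp: s S_def index_chains_def)
    have pre: "J (r - 1) \<in> {1..n}" "I (r - 1) \<in> {1..n}" "J (r - 1) \<le> I (r - 1)"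
      if "r \<in> {1..Suc m}" "r \<noteq> 1" for r
    proof -
      have "r - 1 \<in> {1..m}" using that by auto
      then show "J (r - 1) \<in> {1..n}" "I (r - 1) \<in> {1..n}" "J (r - 1) \<le> I (r - 1)"
        using JI(1,2,4) by (auto simp: PiE_iff)
    qed
    \<comment> \<open>At the junction \<open>r = 1\<close> this is the condition
      \<open>i < j\<close>; all other cases come from the old chain.\<close>
    have step: "(if r = 1 then i else I (r - 1)) < J r" if "r \<in> {1..<Suc m}" for r
      using JI(3) JI(5)[of "r - 1"] i j that by (cases r) auto
    show ?thesis
      unfolding s join_def index_chains_def using i j JI(3) pre step assms
      by (auto simp: PiE_iff)
  qed
  have split_chain: "split s \<in> S" if "s \<in> index_chains n (Suc m) a" for s
  proof -
    obtain J I where s: "s = (J, I)" by (cases s)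
    have J: "J r \<in> {1..n}" and I: "I r \<in> {1..n}" if "r \<in> {1..Suc m}" for r
      using that \<open>s \<in> _\<close> by (auto simp: s index_chains_def PiE_iff)
    have JI: "J 1 = a" "\<And>r. r \<in> {1..Suc m} \<Longrightarrow> J r \<le> I r"
      "\<And>r. r \<in> {1..<Suc m} \<Longrightarrow> I r < J (r + 1)"
      using that by (auto simp: s index_chains_def)
    have "J (Suc r) \<in> {1..n}" "I (Suc r) \<in> {1..n}" "J (Suc r) \<le> I (Suc r)"
      if "r \<in> {1..m}" for r
      using J[of "Suc r"] I[of "Suc r"] JI(2)[of "Suc r"] that by auto
    moreover have "I (Suc r) < J (Suc (Suc r))" if "r \<in> {1..<m}" for r
      using JI(3)[of "Suc r"] that by auto
    ultimately have "(\<lambda>r\<in>{1..m}. J (r + 1), \<lambda>r\<in>{1..m}. I (r + 1)) \<in> index_chains n m (J 2)"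
      unfolding index_chains_def using assms by (auto simp: PiE_iff numeral_2_eq_2)
    moreover have "a \<le> I 1" "I 1 \<le> n" "I 1 < J 2" "J 2 \<le> n"
      using JI(1) JI(2)[of 1] JI(3)[of 1] I[of 1] J[of 2] assms by (auto simp: numeral_2_eq_2)
    ultimately show ?thesis
      unfolding s split_def S_def by simp
  qed
  have split_join: "split (join s) = s" if "s \<in> S" for s
    using that assms
    by (auto simp: split_def join_def S_def index_chains_def PiE_iff extensional_def fun_eq_iff)
  have join_split: "join (split s) = s" if "s \<in> index_chains n (Suc m) a" for s
    using that assms
    by (auto simp: split_def join_def index_chains_def PiE_iff extensional_def fun_eq_iff)
  have "Q H n (Suc m) a =
      (\<Sum>(i, j, J, I)\<in>S. entry H i a * (\<Prod>r=1..m. entry H (I r) (J r)))"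
    unfolding Q_def
  proof (rule sum.reindex_bij_witness[where j = split and i = join])
    fix s assume s: "s \<in> index_chains n (Suc m) a"
    show "(case split s of (i, j, J, I) \<Rightarrow> entry H i a * (\<Prod>r=1..m. entry H (I r) (J r))) =
        (case s of (J, I) \<Rightarrow> \<Prod>r=1..Suc m. entry H (I r) (J r))"
    proof -
      obtain J I where [simp]: "s = (J, I)" by (cases s)
      have "J 1 = a" using s by (simp add: index_chains_def)
      then have "(\<Prod>r=1..Suc m. entry H (I r) (J r)) =
          entry H (I 1) a * (\<Prod>r=Suc 1..Suc m. entry H (I r) (J r))"
        by (subst prod.atLeast_Suc_atMost) auto
      also have "(\<Prod>r=Suc 1..Suc m. entry H (I r) (J r)) =
          (\<Prod>r=1..m. entry H (I (Suc r)) (J (Suc r)))"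
        by (rule prod.shift_bounds_cl_Suc_ivl)
      finally show ?thesis by (simp add: split_def)
    qed
  qed (use join_chain split_chain split_join join_split in auto)
  also have "\<dots> = (\<Sum>i=a..n. \<Sum>j=i+1..n. \<Sum>(J, I)\<in>index_chains n m j.
      entry H i a * (\<Prod>r=1..m. entry H (I r) (J r)))"
    unfolding S_def by (simp add: sum.Sigma finite_index_chains case_prod_beta)
  also have "\<dots> = (\<Sum>i=a..n. entry H i a * (\<Sum>j=i+1..n. Q H n m j))"
    by (simp add: Q_def sum_distrib_left case_prod_beta)
  finally show ?thesis .
qed

text \<open>The starts \<open>J r\<close> strictly increase, so a chain of length \<open>m\<close>
  from \<open>a\<close> reaches at least \<open>a + m - 1\<close>. Hence the coefficient formula for
  \<open>Q_poly\<close> needs no upper bound on the exponent.\<close>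

lemma Q_eq_0:
  assumes "1 \<le> m" "1 \<le> a" "n + 1 < a + m"
  shows "Q H n m a = 0"
  using assms
proof (induction m arbitrary: a rule: nat_induct_at_least)
  case base
  have "index_chains n 1 a = {}"
    using base by (auto simp: index_chains_def PiE_iff)
  then show ?case by (simp add: Q_def)
next
  case (Suc m)
  have "(\<Sum>j=i+1..n. Q H n m j) = 0" if "i \<in> {a..n}" for i
    using that Suc by (intro sum.neutral ballI Suc.IH) auto
  then show ?case using Suc by (simp add: Q_Suc)
qed

text \<open>The constant polynomial at index \<open>N\<close> makes the case \<open>k = N\<close> of the certificates and the
  empty tail of the recursion for \<open>Q\<close> instances of the general case.\<close>

definition Q_poly :: "nat \<Rightarrow> real mat \<Rightarrow> nat \<Rightarrow> real poly" where
  "Q_poly N H j = (if j = N then 1 else \<Sum>m=1..N-j. monom (Q H (N - 1) m j) m)"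

lemma Q_poly_last [simp]: "Q_poly N H N = 1"
  by (simp add: Q_poly_def)

lemma coeff_Q_poly:
  assumes "1 \<le> j" "j < N"
  shows "coeff (Q_poly N H j) m = (if m = 0 then 0 else Q H (N - 1) m j)"
proof -
  have "coeff (Q_poly N H j) m = (if m \<in> {1..N-j} then Q H (N - 1) m j else 0)"
    using assms by (simp add: Q_poly_def coeff_sum coeff_monom)
  then show ?thesis using assms Q_eq_0[of m j "N - 1" H] by auto
qed

text \<open>Coefficientwise this is \<open>Q_Suc\<close>, except that the linear coefficient is
  \<open>Q_one\<close>: there only the constant summand \<open>Q_poly N H N = 1\<close> of each tail
  contributes.\<close>

lemma Q_poly_rec:
  assumes "1 \<le> a" "a < N"
  shows "Q_poly N H a =
    [:0, 1:] * (\<Sum>k=a..N-1. smult (entry H k a) (\<Sum>j=k+1..N. Q_poly N H j))"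
proof (rule poly_eqI)
  fix m
  let ?s = "\<lambda>k. \<Sum>j=k+1..N. Q_poly N H j"
  have split: "?s k = (\<Sum>j=k+1..N-1. Q_poly N H j) + 1" if "k < N" for k
    using that by (cases N) auto
  show "coeff (Q_poly N H a) m = coeff ([:0, 1:] * (\<Sum>k=a..N-1. smult (entry H k a) (?s k))) m"
  proof (cases m)
    case 0
    then show ?thesis using assms by (simp add: coeff_Q_poly coeff_mult)
  next
    case (Suc m')
    have s0: "coeff (?s k) m' = (if m' = 0 then 1 else \<Sum>j=k+1..N-1. Q H (N - 1) m' j)"
      if "k \<in> {a..N-1}" for k
    proof -
      have k: "k < N" using that assms by auto
      have "coeff (?s k) m' = (\<Sum>j=k+1..N-1. coeff (Q_poly N H j) m') + of_bool (m' = 0)"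
        by (simp only: split[OF k] coeff_add coeff_sum coeff_1)
      also have "(\<Sum>j=k+1..N-1. coeff (Q_poly N H j) m') =
          (\<Sum>j=k+1..N-1. if m' = 0 then 0 else Q H (N - 1) m' j)"
        using that assms by (intro sum.cong refl coeff_Q_poly) auto
      finally show ?thesis by auto
    qed
    have "coeff ([:0, 1:] * (\<Sum>k=a..N-1. smult (entry H k a) (?s k))) m =
        (\<Sum>k=a..N-1. entry H k a * coeff (?s k) m')"
      by (simp add: Suc coeff_sum del: sum.cl_ivl_Suc)
    also have "\<dots> = (\<Sum>k=a..N-1. entry H k a *
        (if m' = 0 then 1 else \<Sum>j=k+1..N-1. Q H (N - 1) m' j))"
      by (intro sum.cong refl) (simp only: s0)
    also have "\<dots> = Q H (N - 1) m a"
      using assms Suc Q_one[of a "N - 1" H] Q_Suc[of a m' H "N - 1"] by (cases m') auto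
    finally show ?thesis using assms Suc by (simp add: coeff_Q_poly)
  qed
qed

section \<open>Certificates as a Gram matrix\<close>

lemma pcompose_monom: "pcompose (monom c m) q = smult c (q ^ m)"
  by (induction m) (simp_all add: monom_0 monom_Suc pcompose_pCons algebra_simps)

lemma pcompose_power: "pcompose (p ^ m) q = pcompose p q ^ m"
  by (induction m) (simp_all add: pcompose_1 pcompose_mult)

lemma pcompose_shift_cancel:
  fixes p :: "'a :: comm_ring_1 poly"
  shows "pcompose (pcompose p [:-1, 1:]) [:1, 1:] = p" "pcompose (pcompose p [:1, 1:]) [:-1, 1:] = p"
  by (simp_all flip: pcompose_assoc add: pcompose_pCons pcompose_idR)

lemma poly_1_eq_sum_coeff:
  fixes p :: "'a :: comm_semiring_1 poly"
  assumes "degree p < n"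
  shows "poly p 1 = (\<Sum>i<n. coeff p i)"
proof -
  have "poly p 1 = (\<Sum>i\<le>degree p. coeff p i)" by (simp add: poly_altdef)
  also have "\<dots> = (\<Sum>i<n. coeff p i)"
    using assms by (intro sum.mono_neutral_left) (auto simp: coeff_eq_0)
  finally show ?thesis .
qed

text \<open>The exponent \<open>l + i\<close> has the parity of \<open>l - i\<close> but splits into
  factors, so that the signs depending on \<open>i\<close> cancel in an inner product of two such
  powers.\<close>

lemma coeff_shift_power:
  "coeff ([:-1, 1:] ^ l) i = (-1) ^ (l + i) * real (l choose i)"
proof (cases "i \<le> l")
  case True
  then have "even (l - i) \<longleftrightarrow> even (l + i)" by simp
  then have "(-1 :: real) ^ (l - i) = (-1) ^ (l + i)"
    by (auto simp: minus_one_power_iff)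
  then show ?thesis using True by (simp add: coeff_linear_poly_power)
next
  case False
  then show ?thesis by (simp add: coeff_eq_0 degree_linear_power)
qed

text \<open>The fixed range makes this bilinear without degree hypotheses; on polynomials of degree
  below \<open>n\<close> it is the Euclidean inner product of the full coefficient vectors.\<close>

definition coeff_inner :: "nat \<Rightarrow> real poly \<Rightarrow> real poly \<Rightarrow> real" where
  "coeff_inner n p q = (\<Sum>i<n. coeff p i * coeff q i)"

lemma coeff_inner_commute: "coeff_inner n p q = coeff_inner n q p"
  by (simp add: coeff_inner_def mult.commute)

lemma coeff_inner_sum_left: "coeff_inner n (\<Sum>x\<in>A. f x) q = (\<Sum>x\<in>A. coeff_inner n (f x) q)"
  unfolding coeff_inner_def by (simp add: coeff_sum sum_distrib_right) (rule sum.swap)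

lemma coeff_inner_sum_right: "coeff_inner n p (\<Sum>x\<in>A. f x) = (\<Sum>x\<in>A. coeff_inner n p (f x))"
  by (simp add: coeff_inner_commute[of n p] coeff_inner_sum_left)

lemma coeff_inner_smult_left: "coeff_inner n (smult c p) q = c * coeff_inner n p q"
  by (simp add: coeff_inner_def sum_distrib_left mult.assoc)

lemma coeff_inner_smult_right: "coeff_inner n p (smult c q) = c * coeff_inner n p q"
  by (simp add: coeff_inner_commute[of n p] coeff_inner_smult_left)

lemma coeff_inner_minus:
  "coeff_inner n (- p) q = - coeff_inner n p q" "coeff_inner n p (- q) = - coeff_inner n p q"
  by (simp_all add: coeff_inner_def sum_negf)

lemma coeff_inner_one:
  assumes "0 < n"
  shows "coeff_inner n p 1 = coeff p 0"
proof -
  have "coeff_inner n p 1 = (\<Sum>i<n. if i = 0 then coeff p i else 0)"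
    unfolding coeff_inner_def by (intro sum.cong) auto
  then show ?thesis using assms by simp
qed

lemma coeff_inner_shift_powers:
  assumes "m < n"
  shows "coeff_inner n ([:-1, 1:] ^ l) ([:-1, 1:] ^ m) = (-1) ^ (l + m) * real ((l + m) choose m)"
proof -
  have "coeff_inner n ([:-1, 1:] ^ l) ([:-1, 1:] ^ m) =
      (\<Sum>i<n. (-1) ^ (l + m) * real ((l choose i) * (m choose i)))"
    unfolding coeff_inner_def coeff_shift_power
    by (intro sum.cong refl) (simp add: power_add flip: power_mult_distrib)
  also have "\<dots> = (\<Sum>i\<le>m. (-1) ^ (l + m) * real ((l choose i) * (m choose i)))"
    using assms by (intro sum.mono_neutral_right) auto
  also have "\<dots> = (-1) ^ (l + m) * real (\<Sum>i\<le>m. (l choose i) * (m choose (m - i)))"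
    by (simp add: sum_distrib_left flip: binomial_symmetric)
  finally show ?thesis by (simp only: vandermonde)
qed

text \<open>The kernel \<open>(-1) ^ (\<ell> + m) * (\<ell> + m choose m)\<close> of the certificates becomes diagonal after
  the shift, by Vandermonde's identity (\<open>coeff_inner_shift_powers\<close>).\<close>

definition U_poly :: "nat \<Rightarrow> real mat \<Rightarrow> nat \<Rightarrow> real poly" where
  "U_poly N H j = - pcompose (Q_poly N H j) [:-1, 1:]"

lemma Q_poly_eq_U_poly: "Q_poly N H j = - pcompose (U_poly N H j) [:1, 1:]"
  by (simp add: U_poly_def pcompose_uminus pcompose_shift_cancel)

lemma U_poly_last [simp]: "U_poly N H N = - 1"
  by (simp add: U_poly_def pcompose_1)

lemma U_poly_rec:
  assumes "1 \<le> a" "a < N"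
  shows "U_poly N H a =
    [:-1, 1:] * (\<Sum>k=a..N-1. smult (entry H k a) (\<Sum>j=k+1..N. U_poly N H j))"
  unfolding U_poly_def Q_poly_rec[OF assms]
  by (simp add: pcompose_mult pcompose_sum pcompose_smult pcompose_pCons sum_negf
      del: sum.cl_ivl_Suc)

text \<open>The recursion exhibits the factor \<open>z - 1\<close>.\<close>

lemma poly_U_poly_1:
  assumes "1 \<le> j" "j < N"
  shows "poly (U_poly N H j) 1 = 0"
  by (simp add: U_poly_rec[OF assms])

lemma degree_Q_poly_le: "degree (Q_poly N H j) \<le> N - j"
  unfolding Q_poly_def by (auto intro!: degree_sum_le order.trans[OF degree_monom_le])

lemma degree_U_poly_le: "degree (U_poly N H j) \<le> N - j"
  using degree_Q_poly_le[of N H j] by (simp add: U_poly_def degree_pcompose)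

lemma U_poly_expand:
  assumes "j < N"
  shows "U_poly N H j = - (\<Sum>m=1..N-j. smult (Q H (N - 1) m j) ([:-1, 1:] ^ m))"
  using assms by (simp add: U_poly_def Q_poly_def pcompose_sum pcompose_monom)

text \<open>Both polynomials are expanded in powers of \<open>z - 1\<close>, whose inner products
  are known. The minus sign accounts for the exponent \<open>l + m - 1\<close> in place of
  \<open>l + m\<close>.\<close>

lemma H_cert_eq_inner:
  assumes "1 \<le> j" "j < k" "k \<le> N"
  shows "H_cert N H k j = - real N * coeff_inner N (U_poly N H j) (U_poly N H k)"
proof (cases "k = N")
  case True
  \<comment> \<open>The last polynomial is the constant \<open>- 1\<close>, written as a zeroth
    power so that the same kernel applies with second exponent 0.\<close>
  have "coeff_inner N (U_poly N H j) (U_poly N H k) =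
      - coeff_inner N (U_poly N H j) ([:-1, 1:] ^ 0)"
    using True by (simp add: coeff_inner_minus)
  also have "\<dots> = (\<Sum>m=1..N-j. Q H (N - 1) m j * coeff_inner N ([:-1, 1:] ^ m) ([:-1, 1:] ^ 0))"
    using assms
    by (simp only: U_poly_expand coeff_inner_minus coeff_inner_sum_left coeff_inner_smult_left minus_minus)
  also have "\<dots> = (\<Sum>m=1..N-j. Q H (N - 1) m j * (-1) ^ m)"
    using assms by (subst coeff_inner_shift_powers) auto
  also have "\<dots> = - (\<Sum>m=1..N-j. (-1) ^ (m - 1) * Q H (N - 1) m j)"
    unfolding sum_negf[symmetric] by (intro sum.cong refl) (auto simp: power_eq_if)
  finally show ?thesis using True by (simp add: H_cert_def)
next
  case False
  then have kN: "k < N" using assms by simp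
  have "coeff_inner N (U_poly N H j) (U_poly N H k) =
     (\<Sum>l=1..N-j. \<Sum>m=1..N-k. Q H (N - 1) l j * (Q H (N - 1) m k *
        coeff_inner N ([:-1, 1:] ^ l) ([:-1, 1:] ^ m)))"
    using assms False
    unfolding U_poly_expand[OF less_le_trans[OF assms(2,3)]] U_poly_expand[OF kN]
      coeff_inner_minus minus_minus coeff_inner_sum_left coeff_inner_smult_left
    by (simp only: coeff_inner_sum_right coeff_inner_smult_right sum_distrib_left)
  also have "\<dots> = (\<Sum>l=1..N-j. \<Sum>m=1..N-k. Q H (N - 1) l j * (Q H (N - 1) m k *
        ((-1) ^ (l + m) * real ((l + m) choose m))))"
    using assms by (intro sum.cong refl arg_cong2[where f = "(*)"] coeff_inner_shift_powers) auto
  also have "\<dots> = - (\<Sum>l=1..N-j. \<Sum>m=1..N-k.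
        (-1) ^ (l + m - 1) * real ((l + m) choose m) * Q H (N - 1) l j * Q H (N - 1) m k)"
    unfolding sum_negf[symmetric] by (intro sum.cong refl) (auto simp: power_eq_if)
  finally show ?thesis using False by (simp add: H_cert_def)
qed

definition H_invariant :: "nat \<Rightarrow> real mat \<Rightarrow> bool" where
  "H_invariant N H \<longleftrightarrow>
     (\<forall>m\<in>{1..N-1}. (\<Sum>j=1..N-m. Q H (N - 1) m j) = 1 / real N * real (N choose (m + 1)))"

text \<open>Undoing the shift turns \<open>monom 1 i\<close> into \<open>[:1, 1:] ^ i\<close>, and
  the hockey-stick identity gives the binomials of the invariance condition. The constant
  coefficient is 1 on both sides, and all coefficients from \<open>N\<close> on vanish, so comparing
  polynomials adds no further condition.\<close>

lemma H_invariant_iff: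
  assumes "1 \<le> N"
  shows "H_invariant N H \<longleftrightarrow>
    (\<Sum>j=1..N. U_poly N H j) = - smult (1 / real N) (\<Sum>i<N. monom 1 i)"
proof -
  define R where "R = smult (1 / real N) (\<Sum>i<N. [:1, 1:] ^ i)"
  obtain n where n: "N = Suc n" using assms by (cases N) auto
  have cR: "coeff R m = 1 / real N * real (N choose (m + 1))" for m
  proof -
    have "coeff ([:1, 1::real:] ^ i) m = real (i choose m)" for i
      by (cases "m \<le> i") (simp_all add: coeff_linear_poly_power coeff_eq_0 degree_linear_power)
    then have "coeff R m = 1 / real N * real (\<Sum>i\<le>n. i choose m)"
      by (simp add: R_def coeff_sum n lessThan_Suc_atMost)
    then show ?thesis by (simp add: sum_choose_upper n)
  qed
  have cL: "coeff (\<Sum>j=1..N. Q_poly N H j) m =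
      (if m = 0 then 1 else \<Sum>j=1..N-m. Q H (N - 1) m j)" for m
  proof -
    have "coeff (\<Sum>j=1..N. Q_poly N H j) m =
        (\<Sum>j=1..n. coeff (Q_poly N H j) m) + of_bool (m = 0)"
      by (simp add: n coeff_sum)
    also have "(\<Sum>j=1..n. coeff (Q_poly N H j) m) =
        (\<Sum>j=1..n. if m = 0 then 0 else Q H (N - 1) m j)"
      by (intro sum.cong refl coeff_Q_poly) (auto simp: n)
    also have "\<dots> = (if m = 0 then 0 else \<Sum>j=1..N-m. Q H (N - 1) m j)"
      by (auto simp: n intro!: sum.mono_neutral_right Q_eq_0)
    finally show ?thesis by auto
  qed
  have "H_invariant N H \<longleftrightarrow> (\<Sum>j=1..N. Q_poly N H j) = R"
  proof
    assume inv: "H_invariant N H"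
    show "(\<Sum>j=1..N. Q_poly N H j) = R"
    proof (rule poly_eqI)
      fix m
      consider "m = 0" | "m \<in> {1..N-1}" | "m \<ge> N" by force
      then show "coeff (\<Sum>j=1..N. Q_poly N H j) m = coeff R m"
        using inv assms unfolding cR cL H_invariant_def by cases auto
    qed
  next
    assume "(\<Sum>j=1..N. Q_poly N H j) = R"
    then have "coeff (\<Sum>j=1..N. Q_poly N H j) m = coeff R m" for m by simp
    then show "H_invariant N H"
      unfolding cR cL H_invariant_def by (metis atLeastAtMost_iff not_one_le_zero)
  qed
  also have "\<dots> \<longleftrightarrow> - pcompose (\<Sum>j=1..N. Q_poly N H j) [:-1, 1:] = - pcompose R [:-1, 1:]"
    by (metis minus_equation_iff pcompose_shift_cancel(1))
  also have "pcompose R [:-1, 1:] = smult (1 / real N) (\<Sum>i<N. monom 1 i)"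
    by (simp add: R_def pcompose_smult pcompose_sum monom_altdef pcompose_power pcompose_pCons)
  finally show ?thesis by (simp add: U_poly_def pcompose_sum sum_negf)
qed

section \<open>Optimality of H-invariant methods with nonnegative certificates\<close>

lemma symmetric_sum_pairs:
  fixes f :: "nat \<Rightarrow> nat \<Rightarrow> real"
  assumes "\<And>j k. f j k = f k j" "\<And>k. f k k = 0"
  shows "(\<Sum>k=1..n. \<Sum>j=1..n. f j k) = 2 * (\<Sum>k=1..n. \<Sum>j=1..<k. f j k)"
proof (induction n)
  case (Suc n)
  have "(\<Sum>k=1..Suc n. \<Sum>j=1..Suc n. f j k) =
      (\<Sum>k=1..n. \<Sum>j=1..n. f j k) + (\<Sum>k=1..n. f (Suc n) k) + (\<Sum>j=1..n. f j (Suc n))"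
    by (simp add: sum.distrib assms(2))
  also have "(\<Sum>k=1..n. f (Suc n) k) = (\<Sum>j=1..n. f j (Suc n))"
    by (intro sum.cong refl assms(1))
  finally have E: "(\<Sum>k=1..Suc n. \<Sum>j=1..Suc n. f j k) =
      (\<Sum>k=1..n. \<Sum>j=1..n. f j k) + (\<Sum>j=1..n. f j (Suc n)) + (\<Sum>j=1..n. f j (Suc n))" .
  show ?case unfolding E Suc.IH by (simp add: atLeastLessThanSuc_atLeastAtMost)
qed simp

text \<open>Each pair of distinct indices occurs once among the prefix products, so doubling yields
  the square of the sum and one extra copy of the diagonal.\<close>

lemma sum_prefix_mult:
  fixes g :: "nat \<Rightarrow> real"
  shows "2 * (\<Sum>i<n. (\<Sum>i'\<le>i. g i') * g i) = (\<Sum>i<n. g i)\<^sup>2 + (\<Sum>i<n. (g i)\<^sup>2)"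
proof (induction n)
  case (Suc n)
  have "(\<Sum>i'\<le>n. g i') = (\<Sum>i<n. g i) + g n"
    by (simp add: lessThan_Suc_atMost[symmetric])
  then show ?case using Suc.IH by (simp add: power2_eq_square algebra_simps)
qed simp

text \<open>Both sides range over \<open>1 \<le> a \<le> k < j \<le> N\<close>.\<close>

lemma sum_lower_triangle_swap:
  fixes f :: "nat \<Rightarrow> nat \<Rightarrow> nat \<Rightarrow> real"
  shows "(\<Sum>j=1..N. \<Sum>k=1..<j. \<Sum>a=1..k. f a k j) =
    (\<Sum>a=1..N-1. \<Sum>k=a..N-1. \<Sum>j=k+1..N. f a k j)"
proof -
  have "(\<Sum>j=1..N. \<Sum>k=1..<j. \<Sum>a=1..k. f a k j) =
      (\<Sum>(j, k, a)\<in>(SIGMA j:{1..N}. SIGMA k:{1..<j}. {1..k}). f a k j)"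
    by (simp add: sum.Sigma)
  also have "\<dots> = (\<Sum>(a, k, j)\<in>(SIGMA a:{1..N-1}. SIGMA k:{a..N-1}. {k+1..N}). f a k j)"
    by (rule sum.reindex_bij_witness[where
          i = "\<lambda>(a, k, j). (j, k, a)" and j = "\<lambda>(j, k, a). (a, k, j)"]) auto
  finally show ?thesis by (simp add: sum.Sigma)
qed

context
  fixes N :: nat and H :: "real mat"
  assumes N: "1 \<le> N" and inv: "H_invariant N H"
begin

private abbreviation u :: "nat \<Rightarrow> nat \<Rightarrow> real" where
  "u j i \<equiv> coeff (U_poly N H j) i"

private abbreviation gram :: "nat \<Rightarrow> nat \<Rightarrow> real" where
  "gram j k \<equiv> coeff_inner N (U_poly N H j) (U_poly N H k)"

lemma sum_U_coeff:
  assumes "i < N"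
  shows "(\<Sum>j=1..N. u j i) = - 1 / real N"
proof -
  have "(\<Sum>j=1..N. u j i) = coeff (\<Sum>j=1..N. U_poly N H j) i" by (simp add: coeff_sum)
  also have "\<dots> = - 1 / real N"
    using inv assms by (simp add: H_invariant_iff[OF N] coeff_sum)
  finally show ?thesis .
qed

lemma U_coeff_sum:
  assumes "1 \<le> j" "j \<le> N"
  shows "(\<Sum>i<N. u j i) = (if j = N then - 1 else 0)"
proof -
  have "degree (U_poly N H j) < N"
    using degree_U_poly_le[of N H j] assms by linarith
  then have "(\<Sum>i<N. u j i) = poly (U_poly N H j) 1"
    by (rule poly_1_eq_sum_coeff[symmetric])
  then show ?thesis using assms poly_U_poly_1[of j N H] by auto
qed

text \<open>By H-invariance the row sum pairs \<open>U_poly N H k\<close> with a constant vector,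
  which evaluates that polynomial at 1 up to the factor \<open>- 1 / N\<close>.\<close>

lemma gram_row_sum:
  assumes "1 \<le> k" "k \<le> N"
  shows "(\<Sum>j=1..N. gram j k) = (if k = N then 1 / real N else 0)"
proof -
  have "(\<Sum>j=1..N. gram j k) = (\<Sum>i<N. (\<Sum>j=1..N. u j i) * u k i)"
    unfolding coeff_inner_def sum_distrib_right by (rule sum.swap)
  also have "\<dots> = (\<Sum>i<N. - 1 / real N * u k i)"
    by (intro sum.cong refl arg_cong2[where f = "(*)"] sum_U_coeff) auto
  also have "\<dots> = (if k = N then 1 / real N else 0)"
    unfolding sum_distrib_left[symmetric] using U_coeff_sum[OF assms] by auto
  finally show ?thesis .
qed

text \<open>Expanding the product, the terms \<open>x k * y k\<close> and \<open>x j * y j\<close>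
  meet row sums of the Gram matrix, of which only the last is nonzero. The two mixed terms agree by
  symmetry and factor through the coefficient vectors.\<close>

lemma gram_difference_sum:
  fixes x y :: "nat \<Rightarrow> real"
  shows "(\<Sum>k=1..N. \<Sum>j=1..N. gram j k * ((x k - x j) * (y k - y j))) =
    2 * (x N * y N / real N - (\<Sum>i<N. (\<Sum>j=1..N. u j i * x j) * (\<Sum>j=1..N. u j i * y j)))"
proof -
  define D where "D = (\<Sum>k=1..N. \<Sum>j=1..N. gram j k * (x k * y k))"
  define C where "C = (\<Sum>k=1..N. \<Sum>j=1..N. gram j k * (x j * y k))"
  have swap: "(\<Sum>k=1..N. \<Sum>j=1..N. gram j k * f j k) = (\<Sum>k=1..N. \<Sum>j=1..N. gram j k * f k j)"
    for f :: "nat \<Rightarrow> nat \<Rightarrow> real"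
    by (subst sum.swap) (simp add: coeff_inner_commute)
  have "D = (\<Sum>k=1..N. (if k = N then 1 / real N else 0) * (x k * y k))"
    unfolding D_def sum_distrib_right[symmetric]
    by (intro sum.cong refl arg_cong2[where f = "(*)"] gram_row_sum) auto
  also have "\<dots> = (\<Sum>k\<in>{1..N}. if k = N then x k * y k / real N else 0)"
    by (intro sum.cong) auto
  also have "\<dots> = x N * y N / real N" using N by simp
  finally have D: "D = x N * y N / real N" .
  have "C = (\<Sum>k=1..N. \<Sum>j=1..N. \<Sum>i<N. (u j i * x j) * (u k i * y k))"
    by (simp add: C_def coeff_inner_def sum_distrib_right sum_distrib_left mult_ac)
  also have "\<dots> = (\<Sum>k=1..N. \<Sum>i<N. \<Sum>j=1..N. (u j i * x j) * (u k i * y k))"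
    by (intro sum.cong refl sum.swap)
  also have "\<dots> = (\<Sum>i<N. \<Sum>k=1..N. \<Sum>j=1..N. (u j i * x j) * (u k i * y k))"
    by (rule sum.swap)
  also have "\<dots> = (\<Sum>i<N. (\<Sum>j=1..N. u j i * x j) * (\<Sum>j=1..N. u j i * y j))"
    by (simp add: sum_distrib_left sum_distrib_right mult_ac)
  finally have C: "C = (\<Sum>i<N. (\<Sum>j=1..N. u j i * x j) * (\<Sum>j=1..N. u j i * y j))" .
  have "(\<Sum>k=1..N. \<Sum>j=1..N. gram j k * ((x k - x j) * (y k - y j))) =
      D - C - (\<Sum>k=1..N. \<Sum>j=1..N. gram j k * (x k * y j))
        + (\<Sum>k=1..N. \<Sum>j=1..N. gram j k * (x j * y j))"
    unfolding D_def C_def sum_subtractf[symmetric] sum.distrib[symmetric]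
    by (intro sum.cong refl) (simp add: algebra_simps)
  also have "(\<Sum>k=1..N. \<Sum>j=1..N. gram j k * (x k * y j)) = C"
    unfolding C_def by (rule swap)
  also have "(\<Sum>k=1..N. \<Sum>j=1..N. gram j k * (x j * y j)) = D"
    unfolding D_def by (rule swap)
  finally show ?thesis by (simp add: C D)
qed

text \<open>Multiplication by \<open>z - 1\<close> in the recursion for the U-polynomials is a backward difference
  of coefficients, so partial sums of coefficients recover the multiplied factor.\<close>

lemma U_coeff_prefix_sum:
  assumes "1 \<le> a" "a < N"
  shows "(\<Sum>k=a..N-1. entry H k a * (\<Sum>j=k+1..N. u j i)) = - (\<Sum>i'\<le>i. u a i')"
proof -
  define c where "c = (\<Sum>k=a..N-1. smult (entry H k a) (\<Sum>j=k+1..N. U_poly N H j))"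
  have U: "U_poly N H a = [:-1, 1:] * c"
    unfolding c_def by (rule U_poly_rec[OF assms])
  have "coeff c i = - (\<Sum>i'\<le>i. u a i')"
    by (induction i) (simp_all add: U coeff_pCons)
  then show ?thesis by (simp add: c_def coeff_sum del: sum.cl_ivl_Suc)
qed

section \<open>The certificate identity for one coordinate of the iterates and residuals\<close>

context
  fixes x g :: "nat \<Rightarrow> real"
  assumes step: "\<And>k. 1 \<le> k \<Longrightarrow> k < N \<Longrightarrow> x (k + 1) = x k - (\<Sum>a=1..k. entry H k a * g a)"
begin

lemma iterate_diff:
  assumes "1 \<le> j" "j \<le> N"
  shows "x j - x 1 = - (\<Sum>k=1..<j. \<Sum>a=1..k. entry H k a * g a)"
  using assms by (induction j rule: nat_induct_at_least) (use step in auto)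

text \<open>The differences \<open>x j - x 1\<close> are accumulated steps; after exchanging the
  sums, the recursion for the U-polynomials replaces all entries of \<open>H\<close> by prefix sums
  of coefficients.\<close>

lemma U_transformed_iterates:
  assumes "i < N"
  shows "(\<Sum>j=1..N. u j i * x j) = (\<Sum>i'\<le>i. \<Sum>j=1..N. u j i' * g j) + g N - x 1 / real N"
proof -
  obtain n where n: "N = Suc n" using N by (cases N) auto
  have "(\<Sum>j=1..N. u j i * x j) + x 1 / real N = (\<Sum>j=1..N. u j i * (x j - x 1))"
    using sum_U_coeff[OF assms]
    by (simp add: right_diff_distrib sum_subtractf sum_distrib_right[symmetric] del: sum.cl_ivl_Suc)
  also have "\<dots> = - (\<Sum>j=1..N. \<Sum>k=1..<j. \<Sum>a=1..k. g a * (entry H k a * u j i))"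
    unfolding sum_negf[symmetric]
    by (intro sum.cong refl) (simp add: iterate_diff[unfolded One_nat_def] sum_distrib_left sum_negf mult_ac del: sum.cl_ivl_Suc)
  also have "\<dots> = - (\<Sum>a=1..N-1. g a * (\<Sum>k=a..N-1. entry H k a * (\<Sum>j=k+1..N. u j i)))"
    by (simp only: sum_lower_triangle_swap sum_distrib_left)
  also have "\<dots> = (\<Sum>a=1..N-1. g a * (\<Sum>i'\<le>i. u a i'))"
    unfolding sum_negf[symmetric] by (intro sum.cong refl) (subst U_coeff_prefix_sum, auto)
  \<comment> \<open>Index \<open>N\<close> has no recursion: its prefix sums are all
    \<open>- 1\<close>, so including it must be offset by \<open>g N\<close>.\<close>
  also have "\<dots> = (\<Sum>a=1..N. g a * (\<Sum>i'\<le>i. u a i')) + g N"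
    by (simp add: n sum.atMost_shift)
  also have "(\<Sum>a=1..N. g a * (\<Sum>i'\<le>i. u a i')) = (\<Sum>i'\<le>i. \<Sum>j=1..N. u j i' * g j)"
    unfolding sum_distrib_left by (subst sum.swap) (simp add: mult.commute del: sum.cl_ivl_Suc)
  finally show ?thesis by simp
qed

text \<open>Both quadratic parts are instances of \<open>gram_difference_sum\<close>. The
  transformed iterates are prefix sums of the transformed residuals \<open>G\<close> up to a
  constant, and the sum of squares of \<open>G\<close> produced by \<open>sum_prefix_mult\<close>
  cancels the one from the residual part.\<close>

lemma certificate_identity:
  "(\<Sum>k=1..N. \<Sum>j=1..<k. H_cert N H k j * ((x k - x j) * (g k - g j) - (g k - g j)\<^sup>2 / 2)) =
    (x 1 - x N) * g N - (real N - 1) / 2 * (g N)\<^sup>2"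
proof -
  define X where "X i = (\<Sum>j=1..N. u j i * x j)" for i
  define G where "G i = (\<Sum>j=1..N. u j i * g j)" for i
  define f where "f j k = gram j k * ((x k - x j) * (g k - g j) - (g k - g j)\<^sup>2 / 2)" for j k
  have "(\<Sum>i<N. G i) = (\<Sum>j=1..N. (\<Sum>i<N. u j i) * g j)"
    unfolding G_def sum_distrib_right by (rule sum.swap)
  also have "\<dots> = (\<Sum>j=1..N. (if j = N then - 1 else 0) * g j)"
    by (intro sum.cong refl arg_cong2[where f = "(*)"] U_coeff_sum) auto
  also have "\<dots> = (\<Sum>j=1..N. if j = N then - g j else 0)"
    by (intro sum.cong) auto
  also have "\<dots> = - g N" using N by simp
  finally have sumG: "(\<Sum>i<N. G i) = - g N" .
  have X: "X i = (\<Sum>i'\<le>i. G i') + g N - x 1 / real N" if "i < N" for i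
    unfolding X_def G_def using that by (rule U_transformed_iterates)
  have "(\<Sum>i<N. X i * G i) = (\<Sum>i<N. (\<Sum>i'\<le>i. G i') * G i + (g N - x 1 / real N) * G i)"
    by (intro sum.cong refl) (simp add: X algebra_simps)
  also have "\<dots> = ((g N)\<^sup>2 + (\<Sum>i<N. (G i)\<^sup>2)) / 2 - (g N - x 1 / real N) * g N"
    using sum_prefix_mult[of G N] by (simp add: sum.distrib sum_distrib_left[symmetric] sumG)
  finally have XG: "(\<Sum>i<N. X i * G i) =
    ((g N)\<^sup>2 + (\<Sum>i<N. (G i)\<^sup>2)) / 2 - (g N - x 1 / real N) * g N" .
  have "(\<Sum>k=1..N. \<Sum>j=1..<k. H_cert N H k j * ((x k - x j) * (g k - g j) - (g k - g j)\<^sup>2 / 2)) =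
      - real N * (\<Sum>k=1..N. \<Sum>j=1..<k. f j k)"
    unfolding sum_distrib_left by (intro sum.cong refl) (simp add: H_cert_eq_inner f_def)
  also have "(\<Sum>k=1..N. \<Sum>j=1..<k. f j k) = (\<Sum>k=1..N. \<Sum>j=1..N. f j k) / 2"
  proof -
    have "f j k = f k j" for j k
      by (simp add: f_def coeff_inner_commute power2_eq_square algebra_simps)
    moreover have "f k k = 0" for k by (simp add: f_def)
    ultimately show ?thesis using symmetric_sum_pairs[of f N] by simp
  qed
  also have "(\<Sum>k=1..N. \<Sum>j=1..N. f j k) =
      (\<Sum>k=1..N. \<Sum>j=1..N. gram j k * ((x k - x j) * (g k - g j))) -
      (\<Sum>k=1..N. \<Sum>j=1..N. gram j k * ((g k - g j) * (g k - g j))) / 2"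
    unfolding sum_divide_distrib sum_subtractf[symmetric] f_def
    by (intro sum.cong refl) (simp add: power2_eq_square right_diff_distrib)
  also have "\<dots> = 2 * (x N * g N / real N - (\<Sum>i<N. X i * G i)) -
      ((g N)\<^sup>2 / real N - (\<Sum>i<N. (G i)\<^sup>2))"
    unfolding gram_difference_sum by (simp add: X_def G_def power2_eq_square diff_divide_distrib)
  finally have E: "(\<Sum>k=1..N. \<Sum>j=1..<k. H_cert N H k j *
      ((x k - x j) * (g k - g j) - (g k - g j)\<^sup>2 / 2)) =
    - real N * ((2 * (x N * g N / real N - (\<Sum>i<N. X i * G i)) -
      ((g N)\<^sup>2 / real N - (\<Sum>i<N. (G i)\<^sup>2))) / 2)" .
  show ?thesis
    unfolding E XG using N by (simp add: field_simps power2_eq_square)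
qed

end

end

section \<open>From the scalar identity to the minimax rate\<close>

lemma vnorm_sq:
  assumes "v \<in> carrier_vec d"
  shows "(vnorm v)\<^sup>2 = (\<Sum>c<d. (v $ c)\<^sup>2)"
proof -
  have "v \<bullet> v = (\<Sum>c<d. (v $ c)\<^sup>2)"
    using assms by (simp add: scalar_prod_def power2_eq_square lessThan_atLeast0)
  then show ?thesis by (simp add: vnorm_def sum_nonneg)
qed

text \<open>This is cocoercivity of the residual map: with \<open>e = v - w\<close> and residual
  difference \<open>r\<close>, it is half of \<open>|e - r|^2 \<le> |e|^2\<close>.\<close>

lemma nonexpansive_residual:
  assumes T: "nonexpansive d T" and v: "v \<in> carrier_vec d" and w: "w \<in> carrier_vec d"
  defines "g \<equiv> \<lambda>v c. v $ c - T v $ c"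
  shows "0 \<le> (\<Sum>c<d. (v $ c - w $ c) * (g v c - g w c) - (g v c - g w c)\<^sup>2 / 2)"
proof -
  have Tvw: "T v \<in> carrier_vec d" "T w \<in> carrier_vec d"
    using T v w by (auto simp: nonexpansive_def)
  have "vnorm (T v - T w) \<le> vnorm (v - w)"
    using T v w by (simp add: nonexpansive_def)
  then have "(vnorm (T v - T w))\<^sup>2 \<le> (vnorm (v - w))\<^sup>2"
    by (intro power_mono) (simp_all add: vnorm_def scalar_prod_def sum_nonneg)
  moreover have "(vnorm (T v - T w))\<^sup>2 = (\<Sum>c<d. (T v $ c - T w $ c)\<^sup>2)"
    using Tvw by (subst vnorm_sq[where d = d]) auto
  moreover have "(vnorm (v - w))\<^sup>2 = (\<Sum>c<d. (v $ c - w $ c)\<^sup>2)"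
    using v w by (subst vnorm_sq[where d = d]) auto
  ultimately have "0 \<le> (\<Sum>c<d. ((v $ c - w $ c)\<^sup>2 - (T v $ c - T w $ c)\<^sup>2) / 2)"
    by (simp add: sum_subtractf flip: sum_divide_distrib)
  also have "\<dots> = (\<Sum>c<d. (v $ c - w $ c) * (g v c - g w c) - (g v c - g w c)\<^sup>2 / 2)"
    by (intro sum.cong refl) (simp add: g_def power2_eq_square field_simps)
  finally show ?thesis .
qed

theorem minimax_optimal_if_H_invariant:
  assumes N: "1 \<le> N" and inv: "H_invariant N H"
    and cert: "\<And>j k. 1 \<le> j \<Longrightarrow> j < k \<Longrightarrow> k \<le> N \<Longrightarrow> 0 \<le> H_cert N H k j"
  shows "minimax_optimal N H"
  unfolding minimax_optimal_def
proof (intro allI impI)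
  fix d :: nat and T y ystar
  assume T: "nonexpansive d T" and s: "ystar \<in> carrier_vec d" "T ystar = ystar"
    and y0: "y 0 \<in> carrier_vec d"
    and rec: "\<forall>k<N - 1. y (k + 1) = y k - finsum_vec TYPE(real) d
       (\<lambda>j. entry H (k + 1) (j + 1) \<cdot>\<^sub>v (y j - T (y j))) {0..k}"
  have y: "k < N \<Longrightarrow> y k \<in> carrier_vec d" for k
  proof (induction k rule: less_induct)
    case (less k)
    show ?case
    proof (cases k)
      case (Suc k')
      have "y j - T (y j) \<in> carrier_vec d" if "j \<le> k'" for j
        using less.IH[of j] less.prems that Suc T
        by (auto simp: nonexpansive_def intro!: minus_carrier_vec)
      then have "finsum_vec TYPE(real) d (\<lambda>j. entry H (k' + 1) (j + 1) \<cdot>\<^sub>v (y j - T (y j))) {0..k'}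
          \<in> carrier_vec d"
        by (intro finsum_vec_closed) auto
      then show ?thesis using rec less Suc by auto
    qed (use y0 in simp)
  qed
  \<comment> \<open>The shift by one matches the numbering from 1 used by \<open>entry\<close> and
    the certificates; \<open>x c 1\<close> belongs to \<open>y 0\<close>.\<close>
  define x where "x c k = y (k - 1) $ c" for c k
  define g where "g c k = y (k - 1) $ c - T (y (k - 1)) $ c" for c k
  have step: "x c (k + 1) = x c k - (\<Sum>a=1..k. entry H k a * g c a)"
    if c: "c < d" and k: "1 \<le> k" "k < N" for c k
  proof -
    obtain k' where k': "k = Suc k'" using k by (cases k) auto
    have yj: "y j \<in> carrier_vec d" "T (y j) \<in> carrier_vec d" if "j \<le> k'" for j
      using y[of j] that k k' T by (auto simp: nonexpansive_def)
    have fs: "finsum_vec TYPE(real) d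
        (\<lambda>j. entry H (k' + 1) (j + 1) \<cdot>\<^sub>v (y j - T (y j))) {0..k'} \<in> carrier_vec d"
      using yj by (intro finsum_vec_closed) auto
    have "x c (k + 1) = y k' $ c - finsum_vec TYPE(real) d
        (\<lambda>j. entry H (k' + 1) (j + 1) \<cdot>\<^sub>v (y j - T (y j))) {0..k'} $ c"
      using rec k k' c carrier_vecD[OF fs] by (simp add: x_def)
    also have "finsum_vec TYPE(real) d
        (\<lambda>j. entry H (k' + 1) (j + 1) \<cdot>\<^sub>v (y j - T (y j))) {0..k'} $ c =
        (\<Sum>j\<in>{0..k'}. (entry H (k' + 1) (j + 1) \<cdot>\<^sub>v (y j - T (y j))) $ c)"
      using c yj by (intro index_finsum_vec) auto
    also have "\<dots> = (\<Sum>j=0..k'. entry H (Suc k') (Suc j) * g c (Suc j))"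
      using c carrier_vecD[OF yj(1)] carrier_vecD[OF yj(2)] by (intro sum.cong refl) (simp add: g_def)
    also have "\<dots> = (\<Sum>a=1..k. entry H k a * g c a)"
      by (simp only: k' One_nat_def sum.shift_bounds_cl_Suc_ivl)
    finally show ?thesis by (simp add: x_def k')
  qed
  have res: "0 \<le> (\<Sum>c<d. (x c k - x c j) * (g c k - g c j) - (g c k - g c j)\<^sup>2 / 2)"
    if "1 \<le> j" "j < k" "k \<le> N" for j k
    using nonexpansive_residual[OF T y[of "k - 1"] y[of "j - 1"]] that
    by (simp add: x_def g_def)
  have "0 \<le> (\<Sum>k=1..N. \<Sum>j=1..<k. H_cert N H k j *
      (\<Sum>c<d. (x c k - x c j) * (g c k - g c j) - (g c k - g c j)\<^sup>2 / 2))"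
    by (intro sum_nonneg mult_nonneg_nonneg cert res) auto
  also have "\<dots> = (\<Sum>c<d. \<Sum>k=1..N. \<Sum>j=1..<k. H_cert N H k j *
      ((x c k - x c j) * (g c k - g c j) - (g c k - g c j)\<^sup>2 / 2))"
    unfolding sum_distrib_left sum.swap[where B = "{..<d}"] by (rule refl)
  also have "\<dots> = (\<Sum>c<d. (x c 1 - x c N) * g c N - (real N - 1) / 2 * (g c N)\<^sup>2)"
    by (intro sum.cong refl certificate_identity[OF N inv] step) auto
  finally have iterates: "0 \<le> (\<Sum>c<d. (x c 1 - x c N) * g c N - (real N - 1) / 2 * (g c N)\<^sup>2)" .
  \<comment> \<open>The fixed point has residual zero, so only the last residual appears.\<close>
  have star: "0 \<le> (\<Sum>c<d. (x c N - ystar $ c) * g c N - (g c N)\<^sup>2 / 2)"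
    using nonexpansive_residual[OF T y[of "N - 1"] s(1)] N by (simp add: x_def g_def s(2))
  note add_nonneg_nonneg[OF iterates star]
  also have "(\<Sum>c<d. (x c 1 - x c N) * g c N - (real N - 1) / 2 * (g c N)\<^sup>2) +
      (\<Sum>c<d. (x c N - ystar $ c) * g c N - (g c N)\<^sup>2 / 2) =
      (\<Sum>c<d. (x c 1 - ystar $ c) * g c N - real N / 2 * (g c N)\<^sup>2)"
    unfolding sum.distrib[symmetric] by (intro sum.cong refl) (simp add: field_simps)
  also have "\<dots> \<le> (\<Sum>c<d. (x c 1 - ystar $ c)\<^sup>2 / real N - real N / 4 * (g c N)\<^sup>2)"
  proof (rule sum_mono)
    fix c
    let ?a = "x c 1 - ystar $ c"
    \<comment> \<open>Young's inequality, weighted so that the mixed term costs exactly half of the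
      quadratic term in \<open>g c N\<close>.\<close>
    have "0 \<le> (?a - real N / 2 * g c N)\<^sup>2 / real N" by simp
    also have "\<dots> = ?a\<^sup>2 / real N - ?a * g c N + real N / 4 * (g c N)\<^sup>2"
      using N by (simp add: power2_eq_square field_simps)
    finally show "?a * g c N - real N / 2 * (g c N)\<^sup>2 \<le> ?a\<^sup>2 / real N - real N / 4 * (g c N)\<^sup>2"
      by (simp add: field_simps)
  qed
  also have "\<dots> = (vnorm (y 0 - ystar))\<^sup>2 / real N -
      real N / 4 * (vnorm (y (N - 1) - T (y (N - 1))))\<^sup>2"
  proof -
    have "y (N - 1) \<in> carrier_vec d" using y N by simp
    moreover from this have "T (y (N - 1)) \<in> carrier_vec d" using T by (auto simp: nonexpansive_def)
    ultimately have "(vnorm (y (N - 1) - T (y (N - 1))))\<^sup>2 = (\<Sum>c<d. (g c N)\<^sup>2)"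
      by (subst vnorm_sq[where d = d]) (auto simp: g_def)
    moreover have "(vnorm (y 0 - ystar))\<^sup>2 = (\<Sum>c<d. (x c 1 - ystar $ c)\<^sup>2)"
      using y0 s by (subst vnorm_sq[where d = d]) (auto simp: x_def)
    ultimately show ?thesis
      by (simp add: sum_subtractf sum_divide_distrib sum_distrib_left)
  qed
  finally show "(vnorm (y (N - 1) - T (y (N - 1))))\<^sup>2 \<le> 4 * (vnorm (y 0 - ystar))\<^sup>2 / (real N)\<^sup>2"
    using N by (simp add: power2_eq_square field_simps)
qed

section \<open>The correspondence between matrices and Q-functions\<close>

text \<open>Among the terms with nonzero scalar, nothing can cancel the leading coefficient of the
  one of largest degree.\<close>

lemma distinct_degrees_independent:
  fixes S :: "'a \<Rightarrow> 'b :: field poly"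
  assumes fin: "finite A" and nz: "\<And>i. i \<in> A \<Longrightarrow> S i \<noteq> 0" and inj: "inj_on (\<lambda>i. degree (S i)) A"
    and zero: "(\<Sum>i\<in>A. smult (c i) (S i)) = 0" and i: "i \<in> A"
  shows "c i = 0"
proof (rule ccontr)
  assume "c i \<noteq> 0"
  define B where "B = {i\<in>A. c i \<noteq> 0}"
  have "finite B" "B \<noteq> {}" using fin i \<open>c i \<noteq> 0\<close> by (auto simp: B_def)
  then have "Max ((\<lambda>i. degree (S i)) ` B) \<in> (\<lambda>i. degree (S i)) ` B" by (intro Max_in) auto
  then obtain m where m: "m \<in> B" and "degree (S m) = Max ((\<lambda>i. degree (S i)) ` B)" by auto
  then have max: "degree (S k) \<le> degree (S m)" if "k \<in> B" for k
    using that \<open>finite B\<close> by simp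
  have "0 = coeff (\<Sum>i\<in>A. smult (c i) (S i)) (degree (S m))" by (simp add: zero)
  also have "\<dots> = (\<Sum>i\<in>A. c i * coeff (S i) (degree (S m)))" by (simp add: coeff_sum)
  also have "\<dots> = (\<Sum>i\<in>{m}. c i * coeff (S i) (degree (S m)))"
  proof (rule sum.mono_neutral_right)
    show "\<forall>k\<in>A - {m}. c k * coeff (S k) (degree (S m)) = 0"
    proof
      fix k assume k: "k \<in> A - {m}"
      show "c k * coeff (S k) (degree (S m)) = 0"
      proof (cases "c k = 0")
        case False
        then have "degree (S k) \<le> degree (S m)" using k max by (auto simp: B_def)
        moreover have "degree (S k) \<noteq> degree (S m)"
          using k m inj by (auto simp: B_def inj_on_def)
        ultimately show ?thesis by (simp add: coeff_eq_0)
      qed simp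
    qed
  qed (use fin m in \<open>auto simp: B_def\<close>)
  finally have "c m * lead_coeff (S m) = 0" by simp
  then show False using m nz by (simp add: B_def)
qed

text \<open>Elimination from the top degree. The top scalar is recorded because it becomes a
  diagonal entry of \<open>H\<close>, which must be nonzero.\<close>

lemma graded_family_spans:
  fixes S :: "nat \<Rightarrow> 'a :: field poly"
  assumes "\<And>i. i \<le> n \<Longrightarrow> degree (S i) = i \<and> S i \<noteq> 0" and "degree p \<le> n"
  shows "\<exists>c. p = (\<Sum>i\<le>n. smult (c i) (S i)) \<and> c n = coeff p n / lead_coeff (S n)"
  using assms
proof (induction n arbitrary: p)
  case 0
  obtain a b where "p = [:a:]" "S 0 = [:b:]" "b \<noteq> 0"
    using 0 by (metis degree_eq_zeroE le_zero_eq pCons_0_0)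
  then show ?case by (intro exI[of _ "\<lambda>_. a / b"]) simp
next
  case (Suc n)
  define a where "a = coeff p (Suc n) / lead_coeff (S (Suc n))"
  have S: "degree (S (Suc n)) = Suc n" "S (Suc n) \<noteq> 0" using Suc.prems(1) by auto
  then have lc: "coeff (S (Suc n)) (Suc n) \<noteq> 0" by (metis leading_coeff_0_iff)
  have "degree (p - smult a (S (Suc n))) \<le> n"
  proof (rule degree_le, intro allI impI)
    fix i assume "n < i"
    then show "coeff (p - smult a (S (Suc n))) i = 0"
      using S lc Suc.prems(2) by (cases "i = Suc n") (auto simp: a_def coeff_eq_0)
  qed
  then obtain c where c: "p - smult a (S (Suc n)) = (\<Sum>i\<le>n. smult (c i) (S i))"
    using Suc.IH[of "p - smult a (S (Suc n))"] Suc.prems(1) by (metis le_SucI)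
  have "(\<Sum>i\<le>n. smult ((c(Suc n := a)) i) (S i)) = (\<Sum>i\<le>n. smult (c i) (S i))"
    by (intro sum.cong) auto
  then have "p = (\<Sum>i\<le>Suc n. smult ((c(Suc n := a)) i) (S i))"
    using c by (simp add: algebra_simps)
  then show ?case by (intro exI[of _ "c(Suc n := a)"]) (simp add: a_def)
qed

text \<open>The first summand alone has the largest degree. So the tails form a graded family, with
  respect to which the columns of \<open>H\<close> are coordinate vectors.\<close>

lemma tail_sum_degree:
  fixes P :: "nat \<Rightarrow> 'a :: field poly"
  assumes "\<And>j. k < j \<Longrightarrow> j \<le> N \<Longrightarrow> degree (P j) = N - j \<and> P j \<noteq> 0" and "k < N"
  shows "degree (\<Sum>j=k+1..N. P j) = N - 1 - k \<and> (\<Sum>j=k+1..N. P j) \<noteq> 0"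
proof -
  have split: "(\<Sum>j=k+1..N. P j) = P (k + 1) + (\<Sum>j=k+2..N. P j)"
    using assms(2) by (simp add: sum.atLeast_Suc_atMost)
  have P: "degree (P (k + 1)) = N - 1 - k" "P (k + 1) \<noteq> 0"
    using assms(1)[of "k + 1"] assms(2) by auto
  show ?thesis
  proof (cases "k + 1 = N")
    case False
    have "degree (\<Sum>j=k+2..N. P j) \<le> N - 2 - k"
      using assms by (intro degree_sum_le) auto
    then have "degree (\<Sum>j=k+2..N. P j) < degree (P (k + 1))"
      using False assms(2) P by linarith
    then show ?thesis unfolding split using P by (metis degree_0 degree_add_eq_left not_less_zero)
  qed (use split P in simp)
qed

text \<open>The top coefficient at \<open>j\<close> is \<open>entry H j j\<close> times the one at
  \<open>j + 1\<close>, because shorter tails have too small a degree to contribute.\<close>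

lemma degree_Q_poly:
  assumes H: "H \<in> lower_triangular_nz (N - 1)" and "1 \<le> j" "j \<le> N"
  shows "degree (Q_poly N H j) = N - j \<and> Q_poly N H j \<noteq> 0"
  using \<open>j \<le> N\<close> \<open>1 \<le> j\<close>
proof (induction j rule: inc_induct)
  case (step j)
  have ih: "coeff (Q_poly N H (Suc j)) (N - Suc j) \<noteq> 0"
    using step.IH by (metis le_add1 leading_coeff_0_iff plus_1_eq_Suc)
  have hz: "coeff (Q_poly N H i) (N - Suc j) = 0" if "Suc j < i" "i \<le> N" for i
    using that degree_Q_poly_le[of N H i] by (intro coeff_eq_0) linarith
  define S where "S k = (\<Sum>i=k+1..N. coeff (Q_poly N H i) (N - Suc j))" for k
  have Sz: "S k = 0" if "j < k" for k
    unfolding S_def using that by (intro sum.neutral ballI hz) auto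
  have Sj: "S j = coeff (Q_poly N H (Suc j)) (N - Suc j)"
  proof -
    have "(\<Sum>i=Suc j..N. coeff (Q_poly N H i) (N - Suc j)) =
        coeff (Q_poly N H (Suc j)) (N - Suc j) + (\<Sum>i=Suc (Suc j)..N. coeff (Q_poly N H i) (N - Suc j))"
      using step by (intro sum.atLeast_Suc_atMost) simp
    also have "(\<Sum>i=Suc (Suc j)..N. coeff (Q_poly N H i) (N - Suc j)) = 0"
      by (intro sum.neutral ballI hz) auto
    finally show ?thesis by (simp add: S_def)
  qed
  have "N - j = Suc (N - Suc j)" using step by simp
  then have "coeff (Q_poly N H j) (N - j) = (\<Sum>k=j..N-1. entry H k j * S k)"
    using step by (simp add: Q_poly_rec S_def coeff_sum del: sum.cl_ivl_Suc)
  also have "\<dots> = (\<Sum>k\<in>{j}. entry H k j * S k)"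
    using step by (intro sum.mono_neutral_right) (auto simp: Sz)
  finally have "coeff (Q_poly N H j) (N - j) \<noteq> 0"
    using step H ih by (simp add: Sj lower_triangular_nz_def)
  then show ?case using degree_Q_poly_le[of N H j] by (auto intro: antisym le_degree)
qed simp

lemma coeff_U_poly_top:
  assumes "H \<in> lower_triangular_nz (N - 1)" and "1 \<le> j" "j \<le> N"
  shows "coeff (U_poly N H j) (N - j) \<noteq> 0"
proof -
  have "degree (pcompose (Q_poly N H j) [:-1, 1:]) = N - j"
    using degree_Q_poly[OF assms] by (simp add: degree_pcompose)
  then have "coeff (U_poly N H j) (N - j) = - lead_coeff (pcompose (Q_poly N H j) [:-1, 1:])"
    by (simp add: U_poly_def)
  also have "\<dots> = - lead_coeff (Q_poly N H j)" by (subst lead_coeff_comp) auto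
  finally show ?thesis using degree_Q_poly[OF assms] by (metis leading_coeff_0_iff neg_equal_0_iff_equal)
qed

text \<open>After division by the variable, \<open>P a\<close> expands uniquely in the tails
  \<open>S k\<close> with \<open>a \<le> k < N\<close>, and the scalars are column \<open>a\<close>
  of \<open>H\<close>.\<close>

theorem Q_poly_correspondence:
  fixes P :: "nat \<Rightarrow> real poly"
  assumes PN: "P N = 1"
    and P: "\<And>j. 1 \<le> j \<Longrightarrow> j < N \<Longrightarrow> degree (P j) = N - j \<and> coeff (P j) 0 = 0"
  shows "\<exists>!H. H \<in> lower_triangular_nz (N - 1) \<and> (\<forall>j\<in>{1..N-1}. Q_poly N H j = P j)"
proof (rule ex_ex1I)
  define S where "S k = (\<Sum>j=k+1..N. P j)" for k
  have S: "degree (S k) = N - 1 - k \<and> S k \<noteq> 0" if "k < N" for k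
    unfolding S_def
  proof (rule tail_sum_degree)
    show "degree (P j) = N - j \<and> P j \<noteq> 0" if "k < j" "j \<le> N" for j
      using P[of j] PN that by (cases "j = N") auto
  qed fact
  have "\<exists>c. P a = [:0, 1:] * (\<Sum>k=a..N-1. smult (c k) (S k)) \<and> c a \<noteq> 0" if "a \<in> {1..N-1}" for a
  proof -
    have a: "1 \<le> a" "a < N" using that by auto
    obtain p where p: "P a = [:0, 1:] * p"
      using P[OF a] by (cases "P a" rule: pCons_cases) auto
    then have dp: "degree p = N - 1 - a" "p \<noteq> 0"
      using P[OF a] a by (auto simp: degree_pCons_eq_if split: if_splits)
    \<comment> \<open>Index \<open>i\<close> is the degree here and corresponds to row
      \<open>N - 1 - i\<close>.\<close>
    have basis: "degree (S (N - 1 - i)) = i \<and> S (N - 1 - i) \<noteq> 0" if "i \<le> N - 1 - a" for i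
      using S[of "N - 1 - i"] that a by simp
    obtain c where c: "p = (\<Sum>i\<le>N-1-a. smult (c i) (S (N - 1 - i)))"
      and ca: "c (N - 1 - a) = coeff p (N - 1 - a) / lead_coeff (S (N - 1 - (N - 1 - a)))"
      using graded_family_spans[of "N - 1 - a" "\<lambda>i. S (N - 1 - i)" p, OF basis eq_imp_le[OF dp(1)]]
      by blast
    have "p = (\<Sum>k=a..N-1. smult (c (N - 1 - k)) (S k))"
      unfolding c using a
      by (intro sum.reindex_bij_witness[where i = "\<lambda>k. N - 1 - k" and j = "\<lambda>i. N - 1 - i"]) auto
    moreover have "c (N - 1 - a) \<noteq> 0"
    proof -
      have "coeff p (N - 1 - a) \<noteq> 0" using dp by (metis leading_coeff_0_iff)
      moreover have "S (N - 1 - (N - 1 - a)) \<noteq> 0"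
        using S[of "N - 1 - (N - 1 - a)"] a by simp
      ultimately show ?thesis unfolding ca by (metis divide_eq_0_iff leading_coeff_0_iff)
    qed
    ultimately show ?thesis using p by (intro exI[of _ "\<lambda>k. c (N - 1 - k)"]) simp
  qed
  then obtain h where
    h: "\<And>a. a \<in> {1..N-1} \<Longrightarrow> P a = [:0, 1:] * (\<Sum>k=a..N-1. smult (h a k) (S k)) \<and> h a a \<noteq> 0"
    by metis
  \<comment> \<open>The first argument of \<open>h\<close> is the column; the shifts translate from
    indices counted from 0.\<close>
  define H where "H = mat (N - 1) (N - 1) (\<lambda>(i, j). if j \<le> i then h (j + 1) (i + 1) else 0)"
  have entry_H: "entry H i j = (if j \<le> i then h j i else 0)" if "i \<in> {1..N-1}" "j \<in> {1..N-1}" for i j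
    using that by (auto simp: H_def entry_def)
  have "H \<in> lower_triangular_nz (N - 1)"
    unfolding lower_triangular_nz_def using h by (auto simp: entry_H) (simp add: H_def)
  moreover have "Q_poly N H a = P a" if "1 \<le> a" "a \<le> N" for a
    using \<open>a \<le> N\<close> \<open>1 \<le> a\<close>
  \<comment> \<open>Downward induction from \<open>N\<close>: the recursion at \<open>a\<close>
    refers only to larger indices.\<close>
  proof (induction "N - a" arbitrary: a rule: less_induct)
    case less
    show ?case
    proof (cases "a = N")
      case False
      then have a: "1 \<le> a" "a < N" using less.prems by auto
      have "(\<Sum>j=k+1..N. Q_poly N H j) = S k" if "k \<in> {a..N-1}" for k
        unfolding S_def using that a by (intro sum.cong refl less.hyps) auto
      then have "Q_poly N H a = [:0, 1:] * (\<Sum>k=a..N-1. smult (entry H k a) (S k))"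
        unfolding Q_poly_rec[OF a] by (intro arg_cong2[where f = "(*)"] sum.cong refl) simp
      also have "\<dots> = [:0, 1:] * (\<Sum>k=a..N-1. smult (h a k) (S k))"
        using a by (intro arg_cong2[where f = "(*)"] sum.cong refl) (simp add: entry_H)
      finally show ?thesis using h[of a] a by simp
    qed (use PN in simp)
  qed
  ultimately show "\<exists>H. H \<in> lower_triangular_nz (N - 1) \<and> (\<forall>j\<in>{1..N-1}. Q_poly N H j = P j)"
    by (intro exI[of _ H]) auto
next
  fix H H'
  assume "H \<in> lower_triangular_nz (N - 1) \<and> (\<forall>j\<in>{1..N-1}. Q_poly N H j = P j)"
    and "H' \<in> lower_triangular_nz (N - 1) \<and> (\<forall>j\<in>{1..N-1}. Q_poly N H' j = P j)"
  then have H: "H \<in> lower_triangular_nz (N - 1)" and H': "H' \<in> lower_triangular_nz (N - 1)"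
    and eq: "\<And>j. j \<in> {1..N-1} \<Longrightarrow> Q_poly N H j = P j \<and> Q_poly N H' j = P j"
    by auto
  have eq': "Q_poly N H' j = Q_poly N H j" if "1 \<le> j" "j \<le> N" for j
    using eq[of j] that by (cases "j = N") auto
  \<comment> \<open>Both matrices have the same tails, so the difference of their columns gives a
    vanishing combination of polynomials of distinct degrees.\<close>
  have lower: "entry H k a = entry H' k a" if "1 \<le> a" "a \<le> k" "k \<le> N - 1" for k a
  proof -
    have a: "1 \<le> a" "a < N" using that by auto
    define S where "S k = (\<Sum>j=k+1..N. Q_poly N H j)" for k
    have S: "degree (S k) = N - 1 - k \<and> S k \<noteq> 0" if "k < N" for k
      unfolding S_def using degree_Q_poly[OF H] that by (intro tail_sum_degree) auto
    have S': "(\<Sum>j=k+1..N. Q_poly N H' j) = S k" for k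
      unfolding S_def by (intro sum.cong refl eq') auto
    have "[:0, 1:] * (\<Sum>k=a..N-1. smult (entry H k a) (S k)) =
        [:0, 1:] * (\<Sum>k=a..N-1. smult (entry H' k a) (S k))"
      using Q_poly_rec[OF a, of H] Q_poly_rec[OF a, of H'] eq'[of a] a
      by (simp only: S_def[symmetric] S')
    then have "(\<Sum>k\<in>{a..N-1}. smult (entry H k a - entry H' k a) (S k)) = 0"
      by (simp add: smult_diff_left sum_subtractf)
    then have "entry H k a - entry H' k a = 0"
      using S that a by (intro distinct_degrees_independent[where S = S]) (auto intro!: inj_onI)
    then show ?thesis by simp
  qed
  have all: "entry H i j = entry H' i j" if "i \<in> {1..N-1}" "j \<in> {1..N-1}" for i j
    using H H' that lower[of j i] by (cases "i < j") (auto simp: lower_triangular_nz_def)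
  show "H = H'"
  proof (rule eq_matI)
    fix i j assume "i < dim_row H'" "j < dim_col H'"
    then show "H $$ (i, j) = H' $$ (i, j)"
      using H' all[of "i + 1" "j + 1"] by (auto simp: lower_triangular_nz_def entry_def)
  qed (use H H' in \<open>auto simp: lower_triangular_nz_def\<close>)
qed

section \<open>The Q-functions determined by the sparsity pattern\<close>

text \<open>The coefficients form an unnormalized Helmert contrast: they sum to zero, and contrasts
  for different \<open>M\<close> are orthogonal.\<close>

definition helmert :: "nat \<Rightarrow> real poly" where
  "helmert M = (\<Sum>i<M. monom 1 i) - monom (real M) M"

lemma coeff_helmert: "coeff (helmert M) i = (if i < M then 1 else if i = M then - real M else 0)"
  by (simp add: helmert_def coeff_sum)

lemma coeff_inner_helmert:
  assumes "K < n"
  shows "coeff_inner n p (helmert K) = (\<Sum>i<K. coeff p i) - real K * coeff p K"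
proof -
  have "coeff_inner n p (helmert K) = (\<Sum>i<Suc K. coeff p i * coeff (helmert K) i)"
    unfolding coeff_inner_def using assms
    by (intro sum.mono_neutral_right) (auto simp: coeff_helmert)
  then show ?thesis by (simp add: coeff_helmert)
qed

text \<open>Orthogonality to \<open>helmert K\<close> says that coefficient \<open>K\<close> is the
  mean of all earlier ones, so the coefficients below \<open>M\<close> agree; the root at 1 then
  determines the top one.\<close>

lemma helmert_characterization:
  assumes deg: "degree p \<le> M" and M: "1 \<le> M" "M < n" and p1: "poly p 1 = 0"
    and orth: "\<And>K. 1 \<le> K \<Longrightarrow> K < M \<Longrightarrow> coeff_inner n p (helmert K) = 0"
  shows "p = smult (coeff p 0) (helmert M)"
proof -
  have const: "coeff p i = coeff p 0" if "i < M" for i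
    using that
  proof (induction i rule: less_induct)
    case (less i)
    show ?case
    proof (cases "i = 0")
      case False
      then have "0 = (\<Sum>i'<i. coeff p i') - real i * coeff p i"
        using orth[of i] less.prems M by (simp add: coeff_inner_helmert)
      also have "(\<Sum>i'<i. coeff p i') = (\<Sum>i'<i. coeff p 0)"
        using less by (intro sum.cong refl less.IH) auto
      finally have "real i * (coeff p 0 - coeff p i) = 0" by (auto simp: algebra_simps)
      then have "coeff p 0 = coeff p i" using False by simp
      then show ?thesis by (rule sym)
    qed simp
  qed
  have "0 = (\<Sum>i<Suc M. coeff p i)"
    unfolding poly_1_eq_sum_coeff[OF le_imp_less_Suc[OF deg], symmetric] p1 ..
  also have "\<dots> = (\<Sum>i<M. coeff p 0) + coeff p M"
    unfolding sum.lessThan_Suc by (intro arg_cong2[where f = "(+)"] sum.cong refl const) auto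
  finally have top: "coeff p M = - real M * coeff p 0" by simp
  show ?thesis
  proof (rule poly_eqI)
    fix i
    consider "i < M" | "i = M" | "M < i" by linarith
    then show "coeff p i = coeff (smult (coeff p 0) (helmert M)) i"
    proof cases
      case 1
      then show ?thesis using const[of i] by (simp add: coeff_helmert)
    qed (use top deg in \<open>auto simp: coeff_helmert coeff_eq_0\<close>)
  qed
qed

text \<open>Triangular elimination: once the coefficients of \<open>p\<close> below \<open>i\<close>
  vanish, the inner product with \<open>q i\<close> sees only coefficient \<open>i\<close>.\<close>

lemma low_coeffs_zero:
  assumes p0: "coeff p 0 = 0" and "m \<le> n"
    and q: "\<And>i. 1 \<le> i \<Longrightarrow> i < m \<Longrightarrow> degree (q i) \<le> i \<and> coeff (q i) i \<noteq> 0"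
    and orth: "\<And>i. 1 \<le> i \<Longrightarrow> i < m \<Longrightarrow> coeff_inner n p (q i) = 0"
    and "i < m"
  shows "coeff p i = 0"
  using \<open>i < m\<close>
proof (induction i rule: less_induct)
  case (less i)
  show ?case
  proof (cases "i = 0")
    case False
    have "0 = (\<Sum>i'<n. coeff p i' * coeff (q i) i')"
      using orth[of i] less.prems False by (simp add: coeff_inner_def)
    also have "\<dots> = (\<Sum>i'\<in>{i}. coeff p i' * coeff (q i) i')"
    proof (intro sum.mono_neutral_right ballI)
      fix i' assume i': "i' \<in> {..<n} - {i}"
      show "coeff p i' * coeff (q i) i' = 0"
        using less i' q[of i] False by (cases "i' < i") (auto intro!: disjI2 coeff_eq_0)
    qed (use less.prems \<open>m \<le> n\<close> in auto)
    finally show ?thesis using q[of i] less.prems False by simp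
  qed (use p0 in simp)
qed

text \<open>Only two coefficients can survive, and the root at 1 makes them opposite.\<close>

lemma adjacent_monoms_characterization:
  fixes p :: "real poly"
  assumes deg: "degree p \<le> Suc m" and p1: "poly p 1 = 0" and low: "\<And>i. i < m \<Longrightarrow> coeff p i = 0"
  shows "p = smult (coeff p m) (monom 1 m - monom 1 (Suc m))"
proof -
  define a b where "a = coeff p m" and "b = coeff p (Suc m)"
  have p: "p = monom a m + monom b (Suc m)"
  proof (rule poly_eqI)
    fix i
    consider "i < m" | "i = m" | "i = Suc m" | "i > Suc m" by linarith
    then show "coeff p i = coeff (monom a m + monom b (Suc m)) i"
      by cases (use deg low in \<open>auto simp: coeff_eq_0 a_def b_def\<close>)
  qed
  then have "b = - a" using p1 by (simp add: poly_monom)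
  then show ?thesis
    unfolding a_def[symmetric] by (subst p) (simp add: smult_diff_right smult_monom flip: minus_monom)
qed

context
  fixes N N' :: nat
  assumes N': "2 \<le> N'" "N' \<le> N - 2"
begin

text \<open>Up to scaling, the vanishing certificates force each U-polynomial to be a difference of two
  adjacent monomials (for \<open>j < N'\<close>) or a Helmert contrast, orthogonal to all shorter ones
  (for \<open>j \<ge> N'\<close>).\<close>

definition cert_basis :: "nat \<Rightarrow> real poly" where
  "cert_basis j = (if j < N' then monom 1 (N - j - 1) - monom 1 (N - j) else helmert (N - j))"

text \<open>The scalars dictated by H-invariance: \<open>cert_basis_weighted_sum\<close> shows that
  they work, and the distinct degrees of the basis make them unique.\<close>

definition cert_weight :: "nat \<Rightarrow> real" where
  "cert_weight j = (if j < N' then real j / real N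
     else if j = N' then real N' / (real N * real (N - N'))
     else 1 / (real (N - j) * real (N - j + 1)))"

lemma cert_weight_pos: "1 \<le> j \<Longrightarrow> j < N \<Longrightarrow> cert_weight j > 0"
  using N' by (auto simp: cert_weight_def)

lemma coeff_cert_basis_top: "j < N \<Longrightarrow> coeff (cert_basis j) (N - j) \<noteq> 0"
  by (auto simp: cert_basis_def coeff_helmert)

lemma degree_cert_basis: "j < N \<Longrightarrow> degree (cert_basis j) = N - j"
  using coeff_cert_basis_top[of j]
  by (intro antisym le_degree degree_le) (auto simp: cert_basis_def coeff_helmert)

lemma poly_cert_basis_1: "poly (cert_basis j) 1 = 0"
  by (simp add: cert_basis_def helmert_def poly_monom poly_sum)

text \<open>Summation by parts: consecutive weights differ by 1, so the exponents above
  \<open>N - p\<close> and below \<open>N\<close> receive \<open>- 1\<close>, and exponent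
  \<open>N - p\<close> receives \<open>p - 1\<close>.\<close>

lemma adjacent_monoms_weighted_sum:
  assumes "1 \<le> p" "p \<le> N"
  shows "(\<Sum>j=1..<p. smult (real j) (monom 1 (N - j - 1) - monom 1 (N - j))) =
    monom (real p) (N - p) - (\<Sum>i<N. monom 1 i) + (\<Sum>i<N-p. monom 1 i)"
  using assms
proof (induction p rule: nat_induct_at_least)
  case base
  then obtain n where "N = Suc n" by (cases N) auto
  then show ?case by simp
next
  case (Suc p)
  then have "N - p = Suc (N - Suc p)" by simp
  then show ?case
    using Suc by (simp add: smult_diff_right smult_monom algebra_simps flip: add_monom)
qed

text \<open>The sum telescopes: each weighted contrast is the average of the first \<open>M\<close>
  monomials minus the average of the first \<open>M + 1\<close>.\<close>

lemma helmert_weighted_sum: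
  assumes "1 \<le> m"
  shows "(\<Sum>M=1..<m. smult (1 / (real M * real (M + 1))) (helmert M)) =
    1 - smult (1 / real m) (\<Sum>i<m. monom 1 i)"
  using assms
proof (induction m rule: nat_induct_at_least)
  case base
  then show ?case by (simp add: one_poly_eq_simps monom_0)
next
  case (Suc m)
  have "smult (1 / (real m * real (m + 1))) (helmert m) =
      smult (1 / real m) (\<Sum>i<m. monom 1 i) - smult (1 / real (Suc m)) (\<Sum>i<Suc m. monom 1 i)"
    using Suc.hyps
    by (intro poly_eqI) (auto simp: coeff_helmert coeff_sum field_simps)
  then show ?case using Suc by simp
qed

text \<open>The ranges below and above \<open>N'\<close> telescope separately and leave multiples of
  \<open>monom 1 M\<close> and \<open>?W M\<close>, where \<open>M = N - N'\<close>. The single term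
  at \<open>N'\<close> cancels both.\<close>

lemma cert_basis_weighted_sum:
  "(\<Sum>j=1..N-1. smult (cert_weight j) (cert_basis j)) = 1 - smult (1 / real N) (\<Sum>i<N. monom 1 i)"
proof -
  let ?f = "\<lambda>j. smult (cert_weight j) (cert_basis j)"
  let ?W = "\<lambda>m. \<Sum>i<m. monom (1::real) i"
  define M where "M = N - N'"
  have M: "real N = real M + real N'" "M \<ge> 2" using N' by (auto simp: M_def)
  have set: "{1..N-1} = {1..<N'} \<union> ({N'} \<union> {N'<..<N})" using N' by auto
  have "sum ?f {1..N-1} = sum ?f {1..<N'} + (?f N' + sum ?f {N'<..<N})"
    unfolding set by (subst sum.union_disjoint, auto)+
  also have "sum ?f {1..<N'} = smult (1 / real N)
      (\<Sum>j=1..<N'. smult (real j) (monom 1 (N - j - 1) - monom 1 (N - j)))"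
    by (intro poly_eqI) (simp add: coeff_sum sum_distrib_left cert_weight_def cert_basis_def)
  also have "\<dots> = smult (1 / real N) (monom (real N') M - ?W N + ?W M)"
    using N' by (subst adjacent_monoms_weighted_sum) (auto simp: M_def)
  also have "sum ?f {N'<..<N} = (\<Sum>M=1..<M. smult (1 / (real M * real (M + 1))) (helmert M))"
    using N' by (intro sum.reindex_bij_witness[where i = "\<lambda>m. N - m" and j = "\<lambda>j. N - j"])
      (auto simp: cert_weight_def cert_basis_def M_def)
  also have "\<dots> = 1 - smult (1 / real M) (?W M)"
    using M by (intro helmert_weighted_sum) simp
  also have "?f N' = smult (real N' / (real N * real M)) (?W M - monom (real M) M)"
    by (simp add: cert_weight_def cert_basis_def helmert_def M_def)
  also have "smult (1 / real N) (monom (real N') M - ?W N + ?W M) +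
      (smult (real N' / (real N * real M)) (?W M - monom (real M) M) +
        (1 - smult (1 / real M) (?W M))) = 1 - smult (1 / real N) (?W N)"
  proof (rule poly_eqI)
    fix i
    define q where "q = real N' / (real N * real M)"
    have pos: "real M > 0" "real N > 0" using M(2) N' by auto
    have "1 / real N + q = (real M + real N') / (real N * real M)"
      using pos by (simp add: q_def add_divide_distrib)
    \<comment> \<open>The first equation removes \<open>monom 1 M\<close>, the second removes
      \<open>?W M\<close>.\<close>
    then have q: "real N' / real N = q * real M" "1 / real M = 1 / real N + q"
      using pos by (simp_all add: q_def flip: M(1))
    have key: "1 / real N * (real N' * d - a + b) + (q * (b - real M * d) + (e - 1 / real M * b)) =
        e - 1 / real N * a" for a b d e
    proof -
      have "1 / real N * (real N' * d) = q * real M * d"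
        using arg_cong[OF q(1), of "\<lambda>t. t * d"] by simp
      moreover have "1 / real M * b = 1 / real N * b + q * b"
        unfolding q(2) by (rule distrib_right)
      ultimately show ?thesis unfolding right_diff_distrib distrib_left mult.assoc by linarith
    qed
    have cm: "coeff (monom c M) i = c * of_bool (M = i)" for c :: real
      by simp
    show "coeff (smult (1 / real N) (monom (real N') M - ?W N + ?W M) +
        (smult (real N' / (real N * real M)) (?W M - monom (real M) M) +
        (1 - smult (1 / real M) (?W M)))) i = coeff (1 - smult (1 / real N) (?W N)) i"
      unfolding coeff_add coeff_diff coeff_smult cm q_def[symmetric] by (rule key)
  qed
  finally show ?thesis .
qed

text \<open>Shifting back turns adjacent monomials into a Pascal difference. For a Helmert contrast,
  the hockey-stick identity sums the lower binomials, and absorption merges them with the top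
  term.\<close>

lemma coeff_shifted_cert_basis:
  assumes "1 \<le> j" "j < N" "1 \<le> m"
  shows "coeff (- pcompose (smult (cert_weight j) (cert_basis j)) [:1, 1:]) m = Q_value N N' m j"
proof -
  obtain M where M: "N - j = Suc M" using assms by (cases "N - j") auto
  obtain m' where m': "m = Suc m'" using assms by (cases m) auto
  have cp: "coeff ([:1, 1::real:] ^ i) m = real (i choose m)" for i
    by (cases "m \<le> i") (simp_all add: coeff_linear_poly_power coeff_eq_0 degree_linear_power)
  show ?thesis
  proof (cases "j < N'")
    case True
    have "coeff (- pcompose (smult (cert_weight j) (cert_basis j)) [:1, 1:]) m =
        real j / real N * (real (Suc M choose m) - real (M choose m))"
      using True M
      by (simp add: cert_weight_def cert_basis_def pcompose_smult pcompose_diff pcompose_monom cp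
          right_diff_distrib del: power_Suc binomial_Suc_Suc)
    also have "\<dots> = real j / real N * real (M choose m')"
      by (simp add: m')
    finally show ?thesis using True M m' by (simp add: Q_value_def)
  next
    case False
    have "coeff (- pcompose (smult (cert_weight j) (cert_basis j)) [:1, 1:]) m =
        cert_weight j * (real (Suc M) * real (Suc M choose m) - (\<Sum>i<Suc M. real (i choose m)))"
      using False M
      by (simp add: cert_basis_def helmert_def pcompose_smult pcompose_diff pcompose_sum
          pcompose_monom cp coeff_sum right_diff_distrib del: power_Suc binomial_Suc_Suc sum.lessThan_Suc)
    also have "(\<Sum>i<Suc M. real (i choose m)) = real (Suc M choose Suc m)"
      by (simp add: lessThan_Suc_atMost sum_choose_upper flip: of_nat_sum del: binomial_Suc_Suc)
    also have "real (Suc M) * real (Suc M choose m) - real (Suc M choose Suc m) =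
        real (Suc M) * real (Suc M + 1) / real (m + 1) * real (M choose m')"
    proof -
      have "real (Suc m) * real (Suc M choose Suc m) = real (Suc M) * real (M choose m)"
        using Suc_times_binomial[of m M] unfolding of_nat_mult[symmetric] by (rule arg_cong)
      moreover have "real m * real (Suc M choose m) = real (Suc M) * real (M choose m')"
        using Suc_times_binomial[of m' M] unfolding of_nat_mult[symmetric] m' by (rule arg_cong)
      moreover have "real (Suc M choose m) = real (M choose m) + real (M choose m')"
        by (simp add: m')
      ultimately have "real (Suc m) * real (Suc M choose Suc m) = real (Suc M) * real (M choose m)"
        "real m * real (Suc M choose m) = real (Suc M) * real (M choose m')"
        "real (M choose m) = real (Suc M choose m) - real (M choose m')"
        by linarith+
      then have "real (m + 1) * (real (Suc M) * real (Suc M choose m) - real (Suc M choose Suc m)) =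
          real (Suc M) * real (Suc M + 1) * real (M choose m')"
        by (simp add: algebra_simps del: binomial_Suc_Suc)
      then show ?thesis by (simp add: field_simps)
    qed
    finally have E: "coeff (- pcompose (smult (cert_weight j) (cert_basis j)) [:1, 1:]) m =
      cert_weight j * (real (Suc M) * real (Suc M + 1) / real (m + 1) * real (M choose m'))" .
    \<comment> \<open>Used with \<open>a = N - j\<close>, the factor shared by the weight and the
      contrast.\<close>
    have cancel: "c / (n * a) * (a * b / k * x) = c * b / (n * k) * x" if "a \<noteq> 0"
      for a b c k n x :: real using that by simp
    show ?thesis
    proof (cases "j = N'")
      case True
      have "cert_weight j = real N' / (real N * real (Suc M))"
        using True M by (simp add: cert_weight_def)
      moreover have "Q_value N N' m j = real N' * real (Suc M + 1) / (real N * real (m + 1)) * real (M choose m')"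
        using True M m' by (simp only: Q_value_def of_nat_mult) simp
      ultimately show ?thesis unfolding E by (simp only: cancel of_nat_eq_0_iff nat.simps not_False_eq_True)
    next
      case ne: False
      have "cert_weight j = 1 / (real (Suc M + 1) * real (Suc M))"
        using False ne M by (simp add: cert_weight_def mult.commute)
      moreover have "Q_value N N' m j = 1 * real (Suc M + 1) / (real (Suc M + 1) * real (m + 1)) * real (M choose m')"
        using False ne M m' by (simp add: Q_value_def del: of_nat_Suc)
      ultimately show ?thesis unfolding E by (simp only: cancel of_nat_eq_0_iff nat.simps not_False_eq_True)
    qed
  qed
qed

text \<open>The shift is invertible. After undoing it, both sides have zero constant coefficient and
  degree at most \<open>N - j\<close>, so only the prescribed coefficients remain to be
  compared.\<close>

lemma has_Q_values_iff:
  "has_Q_values N N' H \<longleftrightarrow>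
    (\<forall>j\<in>{1..N-1}. U_poly N H j = smult (cert_weight j) (cert_basis j))"
proof -
  have "(\<forall>k\<in>{1..N-j}. Q H (N - 1) k j = Q_value N N' k j) \<longleftrightarrow>
      U_poly N H j = smult (cert_weight j) (cert_basis j)" if "j \<in> {1..N-1}" for j
  proof -
    have j: "1 \<le> j" "j < N" using that by auto
    let ?V = "smult (cert_weight j) (cert_basis j)"
    have "U_poly N H j = ?V \<longleftrightarrow> Q_poly N H j = - pcompose ?V [:1, 1:]"
      by (metis Q_poly_eq_U_poly minus_equation_iff pcompose_shift_cancel(2))
    also have "\<dots> \<longleftrightarrow> (\<forall>k\<in>{1..N-j}. Q H (N - 1) k j = Q_value N N' k j)"
    proof
      assume "Q_poly N H j = - pcompose ?V [:1, 1:]"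
      then have eq: "coeff (Q_poly N H j) k = coeff (- pcompose ?V [:1, 1:]) k" for k by simp
      show "\<forall>k\<in>{1..N-j}. Q H (N - 1) k j = Q_value N N' k j"
      proof
        fix k assume "k \<in> {1..N-j}"
        then show "Q H (N - 1) k j = Q_value N N' k j"
          using eq[of k] coeff_Q_poly[OF j, of H k] coeff_shifted_cert_basis[OF j, of k] by auto
      qed
    next
      assume vals: "\<forall>k\<in>{1..N-j}. Q H (N - 1) k j = Q_value N N' k j"
      show "Q_poly N H j = - pcompose ?V [:1, 1:]"
      proof (rule poly_eqI)
        fix k
        consider "k = 0" | "k \<in> {1..N-j}" | "N - j < k" by force
        then show "coeff (Q_poly N H j) k = coeff (- pcompose ?V [:1, 1:]) k"
        proof cases
          case 1
          have "coeff (- pcompose ?V [:1, 1:]) 0 = - poly ?V 1"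
            by (simp add: poly_0_coeff_0[symmetric] poly_pcompose)
          then show ?thesis using 1 j by (simp add: coeff_Q_poly poly_cert_basis_1)
        next
          case 2
          then show ?thesis
            using vals coeff_Q_poly[OF j, of H k] coeff_shifted_cert_basis[OF j, of k] by auto
        next
          case 3
          have "degree (- pcompose ?V [:1, 1:]) \<le> N - j"
            using degree_cert_basis[of j] j by (simp add: degree_pcompose)
          then show ?thesis
            using 3 degree_Q_poly_le[of N H j] by (simp add: coeff_eq_0 del: coeff_minus)
        qed
      qed
    qed
    finally show ?thesis by simp
  qed
  then show ?thesis by (simp add: has_Q_values_def)
qed

end

text \<open>For \<open>j \<ge> N'\<close>, orthogonality to the later polynomials, already known to
  be contrasts, gives a contrast. For \<open>j < N'\<close>, orthogonality to all those of degree
  below \<open>N - j - 1\<close> kills the low coefficients. Comparing the H-invariant sum with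
  \<open>cert_basis_weighted_sum\<close> then fixes the scalars.\<close>

lemma cert_conditions_imp_U_poly:
  fixes N N' :: nat
  assumes N': "2 \<le> N'" "N' \<le> N - 2"
    and H: "H \<in> lower_triangular_nz (N - 1)" and inv: "H_invariant N H"
    and low: "\<And>j k. 1 \<le> j \<Longrightarrow> j < N' \<Longrightarrow> j + 2 \<le> k \<Longrightarrow> k \<le> N \<Longrightarrow> H_cert N H k j = 0"
    and high: "\<And>j k. N' \<le> j \<Longrightarrow> j < k \<Longrightarrow> k < N \<Longrightarrow> H_cert N H k j = 0"
    and j: "1 \<le> j" "j < N"
  shows "U_poly N H j = smult (cert_weight N N' j) (cert_basis N N' j)"
proof -
  let ?U = "U_poly N H" and ?B = "cert_basis N N'"
  have zero: "coeff_inner N (?U j) (?U k) = 0" if "H_cert N H k j = 0" "1 \<le> j" "j < k" "k \<le> N" for j k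
    using that by (simp add: H_cert_eq_inner)
  \<comment> \<open>Nonvanishing of \<alpha> belongs to the induction: it lets orthogonality to
    \<open>?U k\<close> pass to the contrast itself.\<close>
  have "\<exists>\<alpha>. ?U j = smult \<alpha> (helmert (N - j)) \<and> \<alpha> \<noteq> 0" if "N' \<le> j" "j < N" for j
    using that
  proof (induction "N - j" arbitrary: j rule: less_induct)
    case less
    have j: "1 \<le> j" using less.prems N' by simp
    have "?U j = smult (coeff (?U j) 0) (helmert (N - j))"
    proof (rule helmert_characterization[of _ _ N])
      fix K assume K: "1 \<le> K" "K < N - j"
      define k where "k = N - K"
      have k: "K = N - k" "j < k" "k < N" using K by (auto simp: k_def)
      have "N - k < N - j" using k by arith
      then obtain \<alpha> where "?U k = smult \<alpha> (helmert K)" "\<alpha> \<noteq> 0"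
        using less.hyps[of k] less.prems k by auto
      moreover have "coeff_inner N (?U j) (?U k) = 0"
        using zero[of k j] high[of j k] k less.prems j by auto
      ultimately show "coeff_inner N (?U j) (helmert K) = 0"
        by (simp add: coeff_inner_smult_right)
    qed (use degree_U_poly_le poly_U_poly_1 j less.prems in auto)
    moreover from this have "coeff (?U j) 0 \<noteq> 0"
      using coeff_U_poly_top[OF H j] less.prems by (metis coeff_0 less_imp_le smult_0_left)
    ultimately show ?case by metis
  qed
  then have high': "\<exists>\<alpha>. ?U j = smult \<alpha> (?B j)" if "N' \<le> j" "j < N" for j
    using that by (fastforce simp: cert_basis_def[OF N'])
  have low': "\<exists>\<alpha>. ?U j = smult \<alpha> (?B j)" if j: "1 \<le> j" "j < N'" for j
  proof -
    have "coeff (?U j) i = 0" if "i < N - j - 1" for i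
    proof (rule low_coeffs_zero[of _ "N - j - 1" N "\<lambda>i. ?U (N - i)"])
      \<comment> \<open>The last polynomial is constant, so the certificate at \<open>k = N\<close>
        supplies the constant coefficient.\<close>
      have "H_cert N H N j = 0" using j N' by (intro low) auto
      then have "coeff_inner N (?U j) (- 1) = 0" using zero[of N j] j N' by simp
      then show "coeff (?U j) 0 = 0"
        using j N' by (simp add: coeff_inner_minus coeff_inner_one)
    next
      fix i assume i: "1 \<le> i" "i < N - j - 1"
      then show "degree (?U (N - i)) \<le> i \<and> coeff (?U (N - i)) i \<noteq> 0"
        using degree_U_poly_le[of N H "N - i"] coeff_U_poly_top[OF H, of "N - i"] by simp
      show "coeff_inner N (?U j) (?U (N - i)) = 0"
        using i j by (intro zero low) auto
    qed (use that in auto)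
    then have "?U j = smult (coeff (?U j) (N - j - 1)) (monom 1 (N - j - 1) - monom 1 (Suc (N - j - 1)))"
      using degree_U_poly_le[of N H j] poly_U_poly_1[of j N H] j N'
      by (intro adjacent_monoms_characterization) auto
    then show ?thesis using j N' by (auto simp: cert_basis_def[OF N'] Suc_diff_Suc)
  qed
  have "\<forall>j. \<exists>\<alpha>. 1 \<le> j \<and> j < N \<longrightarrow> ?U j = smult \<alpha> (?B j)"
    using low' high' by (metis not_le_imp_less)
  then have "\<exists>\<alpha>. \<forall>j. 1 \<le> j \<and> j < N \<longrightarrow> ?U j = smult (\<alpha> j) (?B j)"
    by (rule choice)
  then obtain \<alpha> where \<alpha>: "\<And>j. 1 \<le> j \<Longrightarrow> j < N \<Longrightarrow> ?U j = smult (\<alpha> j) (?B j)" by blast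
  obtain n where n: "N = Suc n" using N' by (cases N) auto
  have "(\<Sum>j=1..N-1. ?U j) = 1 - smult (1 / real N) (\<Sum>i<N. monom 1 i)"
    using inv H_invariant_iff[of N H] n by (simp add: algebra_simps)
  also have "\<dots> = (\<Sum>j=1..N-1. smult (cert_weight N N' j) (?B j))"
    by (rule cert_basis_weighted_sum[OF N', symmetric])
  also have "(\<Sum>j=1..N-1. ?U j) = (\<Sum>j=1..N-1. smult (\<alpha> j) (?B j))"
    using N' by (intro sum.cong refl \<alpha>) auto
  finally have "(\<Sum>j=1..N-1. smult (\<alpha> j - cert_weight N N' j) (?B j)) = 0"
    by (simp add: smult_diff_left sum_subtractf)
  moreover have "?B j \<noteq> 0" if "j < N" for j
    using coeff_cert_basis_top[OF N' that] by auto
  moreover have "inj_on (\<lambda>j. degree (?B j)) {1..N-1}"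
    using N' by (intro inj_onI) (auto simp: degree_cert_basis[OF N'])
  ultimately have "\<alpha> j - cert_weight N N' j = 0"
    using j by (intro distinct_degrees_independent[of "{1..N-1}" ?B]) auto
  then show ?thesis using \<alpha>[OF j] by simp
qed

section \<open>Certificates computed from the prescribed Q-values\<close>

context
  fixes N N' :: nat and H :: "real mat"
  assumes N': "2 \<le> N'" "N' \<le> N - 2" and vals: "has_Q_values N N' H"
begin

lemma U_poly_of_vals:
  assumes "1 \<le> j" "j < N"
  shows "U_poly N H j = smult (cert_weight N N' j) (cert_basis N N' j)"
  using vals assms by (simp add: has_Q_values_iff[OF N'])

lemma H_invariant_of_vals: "H_invariant N H"
proof -
  obtain n where n: "N = Suc n" using N' by (cases N) auto
  have "(\<Sum>j=1..N-1. U_poly N H j) = (\<Sum>j=1..N-1. smult (cert_weight N N' j) (cert_basis N N' j))"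
    using N' by (intro sum.cong refl U_poly_of_vals) auto
  then show ?thesis
    unfolding cert_basis_weighted_sum[OF N'] using H_invariant_iff[of N H] n by simp
qed

lemma H_cert_of_vals:
  assumes "1 \<le> j" "j < k" "k < N"
  shows "H_cert N H k j = - real N * (cert_weight N N' j * cert_weight N N' k) *
    coeff_inner N (cert_basis N N' j) (cert_basis N N' k)"
  using assms
  by (simp add: H_cert_eq_inner U_poly_of_vals coeff_inner_smult_left coeff_inner_smult_right)

lemma H_cert_last_of_vals:
  assumes "1 \<le> j" "j < N"
  shows "H_cert N H N j = real N * cert_weight N N' j * coeff (cert_basis N N' j) 0"
proof -
  have "coeff_inner N p (- 1) = - coeff p 0" for p
    using assms by (simp add: coeff_inner_minus coeff_inner_one)
  then show ?thesis using assms by (simp add: H_cert_eq_inner U_poly_of_vals)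
qed

text \<open>The polynomial at \<open>j\<close> lives in exponents \<open>N - j - 1\<close> and
  \<open>N - j\<close>, above the degree \<open>N - k\<close> of the other one.\<close>

lemma H_cert_low_of_vals:
  assumes "1 \<le> j" "j < N'" "j + 2 \<le> k" "k \<le> N"
  shows "H_cert N H k j = 0"
proof (cases "k = N")
  case True
  then show ?thesis using assms N' by (simp add: H_cert_last_of_vals cert_basis_def[OF N'])
next
  case False
  have "coeff (cert_basis N N' j) i * coeff (cert_basis N N' k) i = 0" for i
  proof (cases "i < N - j - 1")
    case True
    then show ?thesis using assms by (simp add: cert_basis_def[OF N'])
  next
    case ge: False
    then show ?thesis
      using assms False degree_cert_basis[OF N', of k] by (intro disjI2 mult_eq_0_iff[THEN iffD2] coeff_eq_0) auto
  qed
  then have "coeff_inner N (cert_basis N N' j) (cert_basis N N' k) = 0"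
    unfolding coeff_inner_def by (intro sum.neutral) blast
  then show ?thesis using assms False by (simp add: H_cert_of_vals)
qed

lemma H_cert_high_of_vals:
  assumes "N' \<le> j" "j < k" "k < N"
  shows "H_cert N H k j = 0"
proof -
  have "coeff_inner N (cert_basis N N' j) (cert_basis N N' k) = 0"
    using assms N' by (simp add: cert_basis_def[OF N'] coeff_inner_helmert coeff_helmert)
  then show ?thesis using assms N' by (simp add: H_cert_of_vals)
qed

text \<open>The supports meet only in exponent \<open>N - j - 1\<close>, where the first polynomial
  has coefficient 1 and the second its negative top coefficient, also when
  \<open>j + 1 = N'\<close>.\<close>

lemma H_cert_adjacent_pos:
  assumes "1 \<le> j" "j < N'"
  shows "H_cert N H (j + 1) j > 0"
proof -
  let ?B = "cert_basis N N'"
  have deg: "degree (?B (j + 1)) = N - j - 1" using assms N' by (simp add: degree_cert_basis[OF N'])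
  have "coeff_inner N (?B j) (?B (j + 1)) = (\<Sum>i\<in>{N-j-1}. coeff (?B j) i * coeff (?B (j + 1)) i)"
    unfolding coeff_inner_def
  proof (intro sum.mono_neutral_right ballI)
    fix i assume "i \<in> {..<N} - {N-j-1}"
    then consider "i < N - j - 1" | "i > N - j - 1" by fastforce
    then show "coeff (?B j) i * coeff (?B (j + 1)) i = 0"
      by cases (use assms deg in \<open>auto simp: cert_basis_def[OF N'] coeff_eq_0\<close>)
  qed (use assms N' in auto)
  also have "\<dots> = coeff (?B (j + 1)) (N - j - 1)"
    using assms N' by (simp add: cert_basis_def[OF N'])
  also have "\<dots> < 0"
    using assms N' by (auto simp: cert_basis_def[OF N'] coeff_helmert)
  finally have "coeff_inner N (?B j) (?B (j + 1)) < 0" .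
  moreover have "real N * (cert_weight N N' j * cert_weight N N' (j + 1)) > 0"
    using assms N' by (intro mult_pos_pos cert_weight_pos[OF N']) auto
  ultimately have "real N * (cert_weight N N' j * cert_weight N N' (j + 1)) *
      coeff_inner N (?B j) (?B (j + 1)) < 0"
    by (rule mult_pos_neg[rotated])
  then show ?thesis using assms N' H_cert_of_vals[of j "j + 1"] by simp
qed

lemma H_cert_last_pos:
  assumes "N' \<le> j" "j < N"
  shows "H_cert N H N j > 0"
  using assms N' cert_weight_pos[OF N', of j]
  by (simp add: H_cert_last_of_vals cert_basis_def[OF N'] coeff_helmert)

lemma minimax_optimal_of_vals: "minimax_optimal N H"
proof (rule minimax_optimal_if_H_invariant[OF _ H_invariant_of_vals])
  fix j k assume jk: "1 \<le> j" "j < k" "k \<le> N"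
  consider "j < N'" "k = j + 1" | "j < N'" "j + 2 \<le> k" | "N' \<le> j" "k < N" | "N' \<le> j" "k = N"
    using jk by linarith
  then show "0 \<le> H_cert N H k j"
    by cases (use jk H_cert_adjacent_pos[of j] H_cert_low_of_vals[of j k] H_cert_high_of_vals[of j k]
      H_cert_last_pos[of j] in auto)
qed (use N' in simp)

end

text \<open>Positive weights give the polynomials the exact degrees required by the correspondence,
  and the roots at 1 become the vanishing constant coefficients.\<close>

lemma ex1_has_Q_values:
  fixes N N' :: nat
  assumes N': "2 \<le> N'" "N' \<le> N - 2"
  shows "\<exists>!H. H \<in> lower_triangular_nz (N - 1) \<and> has_Q_values N N' H"
proof -
  define V where "V j = smult (cert_weight N N' j) (cert_basis N N' j)" for j
  define P where "P j = (if j = N then 1 else - pcompose (V j) [:1, 1:])" for j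
  have "\<exists>!H. H \<in> lower_triangular_nz (N - 1) \<and> (\<forall>j\<in>{1..N-1}. Q_poly N H j = P j)"
  proof (rule Q_poly_correspondence)
    fix j assume j: "1 \<le> j" "j < N"
    have "degree (P j) = N - j"
      using j cert_weight_pos[OF N' j]
      by (simp add: P_def V_def degree_pcompose degree_cert_basis[OF N'])
    moreover have "coeff (P j) 0 = - poly (V j) 1"
      using j by (simp add: P_def poly_0_coeff_0[symmetric] poly_pcompose)
    ultimately show "degree (P j) = N - j \<and> coeff (P j) 0 = 0"
      by (simp add: V_def poly_cert_basis_1[OF N'])
  qed (simp add: P_def)
  moreover have "(\<forall>j\<in>{1..N-1}. Q_poly N H j = P j) \<longleftrightarrow> has_Q_values N N' H" for H
  proof -
    have "Q_poly N H j = P j \<longleftrightarrow> U_poly N H j = V j" if "j \<in> {1..N-1}" for j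
    proof -
      have "P j = - pcompose (V j) [:1, 1:]" using that N' by (auto simp: P_def)
      then show ?thesis
        by (metis Q_poly_eq_U_poly minus_equation_iff pcompose_shift_cancel(2))
    qed
    then show ?thesis by (simp add: has_Q_values_iff[OF N'] V_def)
  qed
  ultimately show ?thesis by simp
qed

text \<open>The equivalence contains both directions: the listed values satisfy the conditions, and
  no other values do. The second conjunct supplies the corresponding matrix, so that neither
  universal statement is vacuous.\<close>

theorem proposition6:
  fixes N N' :: nat
  assumes "2 \<le> N'" and "N' \<le> N - 2"
  shows
    "(\<forall>H\<in>lower_triangular_nz (N - 1).
        ((\<forall>j\<in>{1..N'-1}. \<forall>k\<in>{j+2..N}. H_cert N H k j = 0) \<and>
         (\<forall>j\<in>{N'..N-1}. \<forall>k\<in>{j+1..N-1}. H_cert N H k j = 0) \<and>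
         (\<forall>m\<in>{1..N-1}. (\<Sum>j=1..N-m. Q H (N - 1) m j) = 1 / real N * real (N choose (m + 1))))
        \<longleftrightarrow> has_Q_values N N' H) \<and>
     (\<exists>!H. H \<in> lower_triangular_nz (N - 1) \<and> has_Q_values N N' H) \<and>
     (\<forall>H\<in>lower_triangular_nz (N - 1). has_Q_values N N' H \<longrightarrow>
        (\<forall>j\<in>{1..N'-1}. H_cert N H (j + 1) j > 0) \<and>
        (\<forall>j\<in>{N'..N-1}. H_cert N H N j > 0) \<and>
        minimax_optimal N H)"
proof (intro conjI ballI impI)
  fix H assume H: "H \<in> lower_triangular_nz (N - 1)"
  show "((\<forall>j\<in>{1..N'-1}. \<forall>k\<in>{j+2..N}. H_cert N H k j = 0) \<and>
      (\<forall>j\<in>{N'..N-1}. \<forall>k\<in>{j+1..N-1}. H_cert N H k j = 0) \<and>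
      (\<forall>m\<in>{1..N-1}. (\<Sum>j=1..N-m. Q H (N - 1) m j) = 1 / real N * real (N choose (m + 1))))
      \<longleftrightarrow> has_Q_values N N' H"
    (is "?certs \<longleftrightarrow> _")
  proof
    assume certs: ?certs
    then have "H_invariant N H" by (simp add: H_invariant_def)
    then show "has_Q_values N N' H"
      unfolding has_Q_values_iff[OF assms] using certs assms
      by (intro ballI cert_conditions_imp_U_poly[OF assms H]) auto
  next
    assume vals: "has_Q_values N N' H"
    show ?certs
    proof (intro conjI)
      show "\<forall>j\<in>{1..N'-1}. \<forall>k\<in>{j+2..N}. H_cert N H k j = 0"
        using assms by (intro ballI H_cert_low_of_vals[OF assms vals]) auto
      show "\<forall>j\<in>{N'..N-1}. \<forall>k\<in>{j+1..N-1}. H_cert N H k j = 0"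
        using assms by (intro ballI H_cert_high_of_vals[OF assms vals]) auto
      show "\<forall>m\<in>{1..N-1}. (\<Sum>j=1..N-m. Q H (N - 1) m j) = 1 / real N * real (N choose (m + 1))"
        using H_invariant_of_vals[OF assms vals] unfolding H_invariant_def .
    qed
  qed
next
  show "\<exists>!H. H \<in> lower_triangular_nz (N - 1) \<and> has_Q_values N N' H"
    by (rule ex1_has_Q_values[OF assms])
next
  fix H j assume "has_Q_values N N' H" "j \<in> {1..N'-1}"
  then show "H_cert N H (j + 1) j > 0" by (intro H_cert_adjacent_pos[OF assms]) auto
next
  fix H j assume "has_Q_values N N' H" "j \<in> {N'..N-1}"
  then show "H_cert N H N j > 0" using assms by (intro H_cert_last_pos[OF assms]) auto
next
  fix H assume "has_Q_values N N' H"
  then show "minimax_optimal N H" by (rule minimax_optimal_of_vals[OF assms])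
qed

end
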